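(* Let $N$ and $n$ be positive integers with $N\ge n+\lceil 2\ln N\rceil$. There is a randomized online algorithm (a modification of the Single-or-Sample algorithm) such that, for every instance with $n$ agents having submodular valuations, with probability $1-O\!\left(\frac1n\right)$ all agents $i\in[n]$ simultaneously receive a bundle $A_i$ with $v_i(A_i)\ge\frac1{24}\,\mathrm{MMS}_i^{N}$, where $\mathrm{MMS}_i^{N}$ is the $1$-out-of-$N$ maximin share of agent $i$.
   Context: There are $m$ indivisible goods $[m]$ and $n$ agents; agent $i$ has a monotone valuation $v_i:2^{[m]}\to\mathbb{R}_+$. Agent $i$ arrives at time $i$; her valuation is then revealed and the algorithm must irrevocably allocate to her a subset $A_i$ of the goods not yet allocated. The algorithm knows $n$ and $[m]$ but nothing about future valuations; valuations are fixed by an oblivious adversary that may know the algorithm but not its coin tosses. The $1$-out-of-$N$ maximin share is $\mathrm{MMS}_i^{N}=\max_{(P_1,\dots,P_N)}\min_{\ell\in[N]} v_i(P_\ell)$ over partitions of $[m]$ into $N$ bundles. The constant in $O(1/n)$ is absolute. *)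

theory Defs
  imports "HOL-Probability.Probability_Mass_Function"
begin

type_synonym valuation = "nat set \<Rightarrow> real"

text \<open>The goods are \<open>{1..m}\<close>. A valuation is a monotone function from subsets of \<open>{1..m}\<close>
  to the nonnegative reals; its values on other sets are irrelevant. The empty bundle is not
  assumed to have value 0.\<close>

definition monotone_valuation :: "nat \<Rightarrow> valuation \<Rightarrow> bool" where
  "monotone_valuation m v \<longleftrightarrow> (\<forall>S\<subseteq>{1..m}. 0 \<le> v S) \<and> mono_on (Pow {1..m}) v"

definition submodular :: "nat \<Rightarrow> valuation \<Rightarrow> bool" where
  "submodular m v \<longleftrightarrow>
    (\<forall>S\<subseteq>{1..m}. \<forall>T\<subseteq>{1..m}. v (S \<union> T) + v (S \<inter> T) \<le> v S + v T)"

text \<open>Bundles of a partition may be empty, as is usual for maximin shares (so that the share is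
  also defined for \<open>m < N\<close>).\<close>

definition bundle_partition :: "nat \<Rightarrow> nat \<Rightarrow> (nat \<Rightarrow> nat set) \<Rightarrow> bool" where
  "bundle_partition m N P \<longleftrightarrow>
    disjoint_family_on P {1..N} \<and> (\<Union>l\<in>{1..N}. P l) = {1..m}"

text \<open>For \<open>N \<ge> 1\<close> the maximum is over a finite nonempty set of reals: all its elements are values
  of subsets of \<open>{1..m}\<close>.\<close>

definition MMS :: "nat \<Rightarrow> nat \<Rightarrow> valuation \<Rightarrow> real" where
  "MMS m N v = Max {Min ((\<lambda>l. v (P l)) ` {1..N}) | P. bundle_partition m N P}"

text \<open>A deterministic online algorithm maps the list of valuations revealed so far (in order of
  arrival, the current agent's last) to the bundle of the current agent. Its own earlier
  decisions are determined by the prefixes of that list, so they need not be passed to it.\<close>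

type_synonym det_online = "valuation list \<Rightarrow> nat set"

definition alloc :: "det_online \<Rightarrow> (nat \<Rightarrow> valuation) \<Rightarrow> nat \<Rightarrow> nat set" where
  "alloc d v i = d (map v [1..<Suc i])"

definition det_online_algorithm :: "nat \<Rightarrow> nat \<Rightarrow> det_online \<Rightarrow> bool" where
  "det_online_algorithm m n d \<longleftrightarrow>
    (\<forall>v. (\<forall>i\<in>{1..n}. monotone_valuation m (v i)) \<longrightarrow>
      (\<forall>i\<in>{1..n}. alloc d v i \<subseteq> {1..m} - (\<Union>j\<in>{1..<i}. alloc d v j)))"

text \<open>Against an oblivious adversary, a randomized online algorithm is a probability distribution
  over deterministic ones: the coin tosses select the deterministic algorithm, independently of
  the valuations.\<close>

definition randomized_online_algorithm :: "nat \<Rightarrow> nat \<Rightarrow> det_online pmf \<Rightarrow> bool" where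
  "randomized_online_algorithm m n R \<longleftrightarrow> (\<forall>d\<in>set_pmf R. det_online_algorithm m n d)"

end

theory Submission
  imports Defs
begin

text \<open>Let \<open>M = N - i\<close> when \<open>i\<close> agents have been served, and let the target of an agent be
  \<open>1/24\<close> of her share. She takes a single remaining good if it reaches the target. Otherwise she
  draws random subsets of the goods at rate \<open>4 / (17 M)\<close> and takes the remaining part of the first
  one that reaches the target, provided that a draw succeeds with probability at least \<open>1/2\<close>; if
  not, she is stuck and takes nothing, so that she does no harm to others.

  Fix an agent and her \<open>N\<close> bundles. A bundle with a good that reaches the target is represented by
  one such good; let \<open>b\<close> be the number of other bundles. The number of surviving representatives,
  plus the number of other bundles weighted by their survival probability, starts at \<open>N\<close>. An
  exponential supermartingale shows that it stays above \<open>5/8 M\<close> except with probability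
  \<open>O(exp (- M / 2))\<close>. If the agent gets stuck, no representative survives, so the small bundles
  have survival weight at least \<open>5/8 M\<close>. By submodularity a random part of them then has enough
  value: colour the small goods at random with about \<open>17/4 M\<close> colours or more; the exponential
  moment of the number of units of value missing from the colour classes is at first dominated by
  that of Poisson variables, and it is preserved by thinning if the colouring rate is raised
  accordingly. Hence the agent gets stuck with probability \<open>O(exp (- M / 2))\<close>, and the sum over
  all agents is \<open>O(1 / N)\<close> because \<open>M > 2 ln N\<close> throughout.\<close>

section \<open>Random subsets\<close>

primrec random_subset :: "nat \<Rightarrow> real \<Rightarrow> nat set pmf" where
  "random_subset 0 q = return_pmf {}"
| "random_subset (Suc m) q =
    bind_pmf (bernoulli_pmf q) (\<lambda>b. map_pmf (\<lambda>S. if b then insert (Suc m) S else S) (random_subset m q))"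

abbreviation E_sub :: "nat \<Rightarrow> real \<Rightarrow> (nat set \<Rightarrow> real) \<Rightarrow> real" where
  "E_sub m q f \<equiv> measure_pmf.expectation (random_subset m q) f"

lemma set_random_subset: "set_pmf (random_subset m q) \<subseteq> Pow {1..m}"
proof (induction m)
  case (Suc m)
  have "(if b then insert (Suc m) S else S) \<in> Pow {1..Suc m}" if "S \<in> set_pmf (random_subset m q)" for b S

  proof -
    have "S \<subseteq> {1..m}" using Suc that by blast
    then show ?thesis by (auto simp: subset_iff)
  qed
  then show ?case unfolding random_subset.simps set_bind_pmf set_map_pmf by blast
qed simp

declare random_subset.simps(2) [simp del]

lemma finite_random_subset [simp]: "finite (set_pmf (random_subset m q))"
  by (rule finite_subset[OF set_random_subset]) simp

lemma integrable_random_subset [simp]: "integrable (measure_pmf (random_subset m q)) (f :: nat set \<Rightarrow> real)"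
  by (rule integrable_measure_pmf_finite) simp

lemma E_sub_0 [simp]: "E_sub 0 q f = f {}"
  by simp

lemma expectation_bind_finite:
  fixes f :: "'b \<Rightarrow> real"
  assumes "finite (set_pmf p)" "\<And>x. x \<in> set_pmf p \<Longrightarrow> finite (set_pmf (g x))"
  shows "measure_pmf.expectation (bind_pmf p g) f
    = measure_pmf.expectation p (\<lambda>x. measure_pmf.expectation (g x) f)"
  using assms by (subst pmf_expectation_bind[where A = "set_pmf p"])
    (auto simp: integral_measure_pmf[of "set_pmf p"])

lemma E_sub_Suc:
  assumes "0 \<le> q" "q \<le> 1"
  shows "E_sub (Suc m) q f = (1 - q) * E_sub m q f + q * E_sub m q (\<lambda>D. f (insert (Suc m) D))"
  using assms by (simp add: random_subset.simps(2) expectation_bind_finite)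

lemma E_sub_cong:
  assumes "\<And>D. D \<subseteq> {1..m} \<Longrightarrow> f D = g D"
  shows "E_sub m q f = E_sub m q g"
  by (rule integral_cong_AE) (use assms set_random_subset[of m q] in \<open>auto simp: AE_measure_pmf_iff\<close>)

lemma E_sub_mono:
  assumes "\<And>D. D \<subseteq> {1..m} \<Longrightarrow> f D \<le> g D"
  shows "E_sub m q f \<le> E_sub m q g"
  by (rule integral_mono_AE) (use assms set_random_subset[of m q] in \<open>auto simp: AE_measure_pmf_iff\<close>)

lemma E_sub_const [simp]: "E_sub m q (\<lambda>_. c) = c"
  by simp

text \<open>A higher rate shifts weight to the sets that contain \<open>Suc m\<close>, where an
  antimonotone \<open>f\<close> is smaller.\<close>

lemma E_sub_antimono_rate:
  assumes "\<And>A B. A \<subseteq> B \<Longrightarrow> f B \<le> f A" "0 \<le> p" "p \<le> q" "q \<le> 1"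
  shows "E_sub m q f \<le> E_sub m p f"
  using assms(1)
proof (induction m arbitrary: f)
  case (Suc m)
  define f1 where "f1 = (\<lambda>D. f (insert (Suc m) D))"
  have 1: "E_sub m q f \<le> E_sub m p f" by (rule Suc.IH) (use Suc.prems in auto)
  have 2: "E_sub m q f1 \<le> E_sub m p f1"
    unfolding f1_def by (rule Suc.IH) (intro Suc.prems insert_mono)
  have 3: "E_sub m p f1 \<le> E_sub m p f"
    unfolding f1_def by (intro E_sub_mono Suc.prems) auto
  have "(1 - q) * E_sub m q f + q * E_sub m q f1 \<le> (1 - q) * E_sub m p f + q * E_sub m p f1"
    using 1 2 assms by (intro add_mono mult_left_mono) auto
  also have "\<dots> = E_sub m p f - q * (E_sub m p f - E_sub m p f1)" by (simp add: algebra_simps)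
  also have "\<dots> \<le> E_sub m p f - p * (E_sub m p f - E_sub m p f1)"
    using 3 assms by (intro diff_left_mono mult_right_mono) auto
  also have "\<dots> = (1 - p) * E_sub m p f + p * E_sub m p f1" by (simp add: algebra_simps)
  finally show ?case using assms by (simp add: E_sub_Suc f1_def)
qed simp

text \<open>The generating function of a binomial variable; \<open>pot1_step\<close> applies it to
  the number of representatives lost.\<close>

lemma E_sub_power_card:
  assumes "0 \<le> q" "q \<le> 1"
  shows "E_sub m q (\<lambda>D. x ^ card (Y \<inter> D)) = (1 - q + q * x) ^ card (Y \<inter> {1..m})"
proof (induction m)
  case (Suc m)
  show ?case
  proof (cases "Suc m \<in> Y")
    case True
    have "E_sub m q (\<lambda>D. x ^ card (Y \<inter> insert (Suc m) D)) = E_sub m q (\<lambda>D. x * x ^ card (Y \<inter> D))"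
    proof (rule E_sub_cong)
      fix D assume D: "D \<subseteq> {1..m}"
      then have "finite (Y \<inter> D)" "Suc m \<notin> Y \<inter> D" using finite_subset by fastforce+
      moreover have "Y \<inter> insert (Suc m) D = insert (Suc m) (Y \<inter> D)" using True by auto
      ultimately show "x ^ card (Y \<inter> insert (Suc m) D) = x * x ^ card (Y \<inter> D)" by simp
    qed
    moreover have "Y \<inter> {1..Suc m} = insert (Suc m) (Y \<inter> {1..m})" using True by auto
    ultimately show ?thesis using assms Suc by (simp add: E_sub_Suc algebra_simps)
  next
    case False
    then have "Y \<inter> insert (Suc m) D = Y \<inter> D" for D by auto
    moreover have "Y \<inter> {1..Suc m} = Y \<inter> {1..m}" using False by (auto simp: le_Suc_eq)
    ultimately show ?thesis using assms Suc by (simp add: E_sub_Suc algebra_simps)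
  qed
qed simp

section \<open>Supermodular functions and the sampling rate\<close>

definition supermodular :: "(nat set \<Rightarrow> real) \<Rightarrow> bool" where
  "supermodular G \<longleftrightarrow> (\<forall>A B. G A + G B \<le> G (A \<union> B) + G (A \<inter> B))"

text \<open>For supermodular \<open>G\<close> the expectation is convex in the rate, and
  \<open>q\<close> is the midpoint of \<open>0\<close> and \<open>2 * q\<close>. The induction
  avoids second derivatives.\<close>

lemma E_sub_double_rate:
  assumes "supermodular G" "0 \<le> q" "2 * q \<le> 1"
  shows "2 * E_sub m q G \<le> E_sub m (2 * q) G + G {}"
  using assms(1)
proof (induction m arbitrary: G)
  case (Suc m)
  define G1 where "G1 = (\<lambda>D. G (insert (Suc m) D))"
  have "supermodular G1"
    unfolding supermodular_def G1_def
  proof safe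
    fix A B
    have "G (insert (Suc m) A) + G (insert (Suc m) B)
        \<le> G (insert (Suc m) A \<union> insert (Suc m) B) + G (insert (Suc m) A \<inter> insert (Suc m) B)"
      using Suc.prems unfolding supermodular_def by blast
    then show "G (insert (Suc m) A) + G (insert (Suc m) B)
        \<le> G (insert (Suc m) (A \<union> B)) + G (insert (Suc m) (A \<inter> B))" by simp
  qed
  then have 1: "2 * E_sub m q G1 \<le> E_sub m (2 * q) G1 + G1 {}" by (rule Suc.IH)
  have 2: "2 * E_sub m q G \<le> E_sub m (2 * q) G + G {}" by (rule Suc.IH[OF Suc.prems])
  \<comment> \<open>The increment caused by \<open>Suc m\<close> is smallest at the empty
    set.\<close>
  have "E_sub m q (\<lambda>D. G1 {} - G {} + G D) \<le> E_sub m q G1"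
  proof (rule E_sub_mono)
    fix D :: "nat set" assume "D \<subseteq> {1..m}"
    then have "{Suc m} \<inter> D = {}" by auto
    moreover have "G {Suc m} + G D \<le> G ({Suc m} \<union> D) + G ({Suc m} \<inter> D)"
      using Suc.prems unfolding supermodular_def by blast
    ultimately show "G1 {} - G {} + G D \<le> G1 D" by (simp add: G1_def)
  qed
  then have 3: "G1 {} - G {} + E_sub m q G \<le> E_sub m q G1" by simp
  have "(1 - 2*q) * (2 * E_sub m q G - G {}) + 2*q * (2 * E_sub m q G1 - G1 {})
      \<le> (1 - 2*q) * E_sub m (2 * q) G + 2*q * E_sub m (2 * q) G1"
    using 1 2 assms by (intro add_mono mult_left_mono) auto
  moreover have "0 \<le> 2 * q * (E_sub m q G1 - (G1 {} - G {} + E_sub m q G))"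
    using 3 assms by (intro mult_nonneg_nonneg) auto
  ultimately show ?case using assms by (simp add: E_sub_Suc G1_def algebra_simps)
qed simp

section \<open>Differentiation in the sampling rate\<close>

text \<open>The polynomial in \<open>q\<close> that agrees with \<open>E_sub\<close> on the unit interval; it can be
  differentiated at the end points too, where \<open>bernoulli_pmf\<close> clips its parameter.\<close>

primrec sub_poly :: "nat \<Rightarrow> real \<Rightarrow> (nat set \<Rightarrow> real) \<Rightarrow> real" where
  "sub_poly 0 q f = f {}"
| "sub_poly (Suc m) q f = (1 - q) * sub_poly m q f + q * sub_poly m q (\<lambda>D. f (insert (Suc m) D))"

lemma E_sub_eq_sub_poly: "0 \<le> q \<Longrightarrow> q \<le> 1 \<Longrightarrow> E_sub m q f = sub_poly m q f"
  by (induction m arbitrary: f) (simp_all add: E_sub_Suc)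

lemma sub_poly_cong: "(\<And>D. D \<subseteq> {1..m} \<Longrightarrow> f D = g D) \<Longrightarrow> sub_poly m q f = sub_poly m q g"
proof (induction m arbitrary: f g)
  case (Suc m)
  have "sub_poly m q f = sub_poly m q g"
    by (rule Suc.IH, rule Suc.prems) auto
  moreover have "sub_poly m q (\<lambda>D. f (insert (Suc m) D)) = sub_poly m q (\<lambda>D. g (insert (Suc m) D))"
    by (rule Suc.IH, rule Suc.prems) auto
  ultimately show ?case by simp
qed simp

lemma sub_poly_add: "sub_poly m q (\<lambda>D. f D + g D) = sub_poly m q f + sub_poly m q g"
  by (induction m arbitrary: f g) (simp_all add: algebra_simps)

lemma sub_poly_diff: "sub_poly m q (\<lambda>D. f D - g D) = sub_poly m q f - sub_poly m q g"
  by (induction m arbitrary: f g) (simp_all add: left_diff_distrib right_diff_distrib)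

text \<open>By the chain rule: if every good had its own rate, the partial derivative in that of
  \<open>g\<close> would be the expected effect of including \<open>g\<close> rather than excluding
  it.\<close>

lemma russo_formula:
  "((\<lambda>q. sub_poly m q f) has_real_derivative
    sub_poly m q (\<lambda>D. \<Sum>g\<in>{1..m}. f (insert g D) - f (D - {g}))) (at q)"
proof (induction m arbitrary: f)
  case (Suc m)
  define f1 where "f1 = (\<lambda>D. f (insert (Suc m) D))"
  have f1: "(\<lambda>D. f (insert (Suc m) D)) = f1" by (simp add: f1_def)
  let ?S = "\<lambda>m f D. \<Sum>g\<in>{1..m}. f (insert g D) - f (D - {g} :: nat set)"
  have "((\<lambda>q. (1 - q) * sub_poly m q f + q * sub_poly m q f1) has_real_derivative
      ((1 - q) * sub_poly m q (?S m f) - sub_poly m q f) + (q * sub_poly m q (?S m f1) + sub_poly m q f1)) (at q)"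
    by (rule derivative_eq_intros refl Suc)+ (simp add: algebra_simps)
  moreover have e1: "sub_poly m q (?S (Suc m) f) = sub_poly m q (\<lambda>D. ?S m f D + (f1 D - f D))"
  proof (rule sub_poly_cong)
    fix D :: "nat set" assume "D \<subseteq> {1..m}"
    then have "D - {Suc m} = D" by auto
    then show "?S (Suc m) f D = ?S m f D + (f1 D - f D)" by (simp add: f1_def)
  qed
  moreover have e2: "sub_poly m q (\<lambda>D. ?S (Suc m) f (insert (Suc m) D))
      = sub_poly m q (\<lambda>D. ?S m f1 D + (f1 D - f D))"
  proof (rule sub_poly_cong)
    fix D :: "nat set" assume "D \<subseteq> {1..m}"
    then have "insert (Suc m) D - {Suc m} = D" by auto
    moreover have "(\<Sum>g\<in>{1..m}. f (insert g (insert (Suc m) D)) - f (insert (Suc m) D - {g})) = ?S m f1 D"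
    proof (rule sum.cong)
      fix g assume "g \<in> {1..m}"
      then have "insert (Suc m) D - {g} = insert (Suc m) (D - {g})" by auto
      then show "f (insert g (insert (Suc m) D)) - f (insert (Suc m) D - {g}) = f1 (insert g D) - f1 (D - {g})"
        by (simp add: f1_def insert_commute)
    qed simp
    ultimately show "?S (Suc m) f (insert (Suc m) D) = ?S m f1 D + (f1 D - f D)" by (simp add: f1_def)
  qed
  ultimately show ?case
    unfolding sub_poly.simps f1 e1 e2 sub_poly_add sub_poly_diff
    by (elim back_subst[where P = "\<lambda>x. (_ has_real_derivative x) _"]) (simp only: algebra_simps)
qed simp

section \<open>The exponential of a shortfall\<close>

definition psi :: "real \<Rightarrow> real \<Rightarrow> real" where
  "psi c z = exp (3/4 * max 0 (c - z))"

lemma psi_pos [simp]: "0 < psi c z" by (simp add: psi_def)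

lemma psi_nonneg [simp]: "0 \<le> psi c z" by (simp add: psi_def)

lemma psi_antimono: "x \<le> y \<Longrightarrow> psi c y \<le> psi c x"
  by (simp add: psi_def)

lemma psi_eq_1: "c \<le> z \<Longrightarrow> psi c z = 1"
  by (simp add: psi_def)

lemma psi_shift: "psi c (z + 1) = psi (c - 1) z"
  by (simp add: psi_def algebra_simps)

text \<open>The shortfall of \<open>z\<close> below \<open>c\<close> is convex in \<open>z\<close>,
  and the exponential is convex and increasing.\<close>

lemma psi_convex: "convex_on UNIV (psi c)"
proof (rule convex_onI)
  fix t x y :: real assume t: "0 < t" "t < 1"
  have "max 0 (c - ((1 - t) * x + t * y)) \<le> (1 - t) * max 0 (c - x) + t * max 0 (c - y)"
  proof -
    have "(1 - t) * (c - x) \<le> (1 - t) * max 0 (c - x)" "t * (c - y) \<le> t * max 0 (c - y)"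
      using t by (auto intro!: mult_left_mono)
    moreover have "0 \<le> (1 - t) * max 0 (c - x)" "0 \<le> t * max 0 (c - y)" using t by auto
    moreover have "c - ((1 - t) * x + t * y) = (1 - t) * (c - x) + t * (c - y)" by (simp add: algebra_simps)
    ultimately show ?thesis by (intro max.boundedI) linarith+
  qed
  then have "3/4 * max 0 (c - ((1 - t) * x + t * y)) \<le> 3/4 * ((1 - t) * max 0 (c - x) + t * max 0 (c - y))"
    by (rule mult_left_mono) simp
  also have "\<dots> = (1 - t) * (3/4 * max 0 (c - x)) + t * (3/4 * max 0 (c - y))"
    by (simp add: field_simps)
  finally have "psi c ((1 - t) * x + t * y) \<le> exp ((1 - t) * (3/4 * max 0 (c - x)) + t * (3/4 * max 0 (c - y)))"
    by (simp add: psi_def)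
  also have "\<dots> \<le> (1 - t) * psi c x + t * psi c y"
    using convex_onD[OF exp_convex, of t "3/4 * max 0 (c - x)" "3/4 * max 0 (c - y)"] t
    by (simp add: psi_def)
  finally show "psi c ((1 - t) *\<^sub>R x + t *\<^sub>R y) \<le> (1 - t) * psi c x + t * psi c y" by simp
qed simp

lemma psi_unit_step:
  assumes "0 \<le> x" "x \<le> 1"
  shows "psi c (z + x) - psi c z \<le> x * (psi c (z + 1) - psi c z)"
  using convex_onD[OF psi_convex, of x z "z + 1" c] assms by (simp add: algebra_simps)

text \<open>Convexity allows the pair \<open>x\<close>, \<open>y\<close> to be spread out to
  \<open>p\<close>, \<open>x + y - p\<close>. The second point is at least \<open>s\<close>, so
  \<open>psi\<close> is no larger there than at \<open>s\<close>. This is how submodularity of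
  \<open>u\<close> becomes supermodularity in \<open>psi_supermodular\<close>.\<close>

lemma psi_crossing:
  assumes "p \<le> x" "p \<le> y" "x \<le> s" "y \<le> s" "p + s \<le> x + y"
  shows "psi c x + psi c y \<le> psi c s + psi c p"
proof (cases "p = x")
  case True
  then show ?thesis using assms psi_antimono[of s y c] psi_antimono[of y s c] by simp
next
  case False
  define s' where "s' = x + y - p"
  have "p < s'" "s \<le> s'" using False assms by (auto simp: s'_def)
  define t where "t = (x - p) / (s' - p)"
  have t: "0 \<le> t" "t \<le> 1" using assms \<open>p < s'\<close> by (auto simp: t_def s'_def field_simps)
  have "t * (s' - p) = x - p" using \<open>p < s'\<close> by (simp add: t_def)
  then have "(1 - t) * p + t * s' = x" "(1 - (1 - t)) * p + (1 - t) * s' = y"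
    by (simp_all add: s'_def algebra_simps)
  then have "psi c x \<le> (1 - t) * psi c p + t * psi c s'" "psi c y \<le> t * psi c p + (1 - t) * psi c s'"
    using convex_onD[OF psi_convex, of t p s' c] convex_onD[OF psi_convex, of "1 - t" p s' c] t by simp_all
  then have "psi c x + psi c y \<le> psi c p + psi c s'" by (simp add: algebra_simps)
  then show ?thesis using psi_antimono[OF \<open>s \<le> s'\<close>, of c] by simp
qed

section \<open>One agent's view and the Poisson comparison\<close>

text \<open>A single agent's view: \<open>u\<close> is her valuation in units of the target value, \<open>Z\<close> contains one
  good of unit value from each bundle that has one, and \<open>U\<close> is the union of the remaining
  bundles \<open>P l\<close>, all of whose goods are small.\<close>

locale agent_view =
  fixes m :: nat and u :: valuation and Z U :: "nat set" and I :: "nat set" and P :: "nat \<Rightarrow> nat set"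
  assumes u_nonneg: "S \<subseteq> {1..m} \<Longrightarrow> 0 \<le> u S"
    and u_mono: "S \<subseteq> T \<Longrightarrow> T \<subseteq> {1..m} \<Longrightarrow> u S \<le> u T"
    and u_submod: "S \<subseteq> {1..m} \<Longrightarrow> T \<subseteq> {1..m} \<Longrightarrow> u (S \<union> T) + u (S \<inter> T) \<le> u S + u T"
    and Z_sub: "Z \<subseteq> {1..m}" and U_sub: "U \<subseteq> {1..m}" and Z_U: "Z \<inter> U = {}"
    and large: "z \<in> Z \<Longrightarrow> 1 \<le> u {z}" and small: "g \<in> U \<Longrightarrow> u {g} \<le> 1"
    and fin_I: "finite I" and P_sub: "l \<in> I \<Longrightarrow> P l \<subseteq> U" and P_disj: "disjoint_family_on P I"
    and P_val: "l \<in> I \<Longrightarrow> 24 \<le> u (P l)"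
begin

lemma marginal_le_1:
  assumes "D \<subseteq> {1..m}" "g \<in> U"
  shows "u (insert g D) \<le> u D + 1"
proof (cases "g \<in> D")
  case False
  then have "u (D \<union> {g}) + u {} \<le> u D + u {g}"
    using u_submod[of D "{g}"] assms U_sub by auto
  then show ?thesis using small[OF assms(2)] u_nonneg[of "{}"] by simp
qed (use assms in \<open>auto simp: insert_absorb\<close>)

lemma marginal_nonneg:
  assumes "D \<subseteq> {1..m}" "g \<in> U"
  shows "u D \<le> u (insert g D)"
  using assms U_sub by (intro u_mono) auto

lemma sum_marginals:
  assumes "finite A" "A \<subseteq> {1..m}" "D \<subseteq> {1..m}"
  shows "u (D \<union> A) - u D \<le> (\<Sum>g\<in>A. u (insert g D) - u D)"
  using assms
proof (induction A rule: finite_induct)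
  case (insert g A)
  have "u ((D \<union> A) \<union> insert g D) + u ((D \<union> A) \<inter> insert g D) \<le> u (D \<union> A) + u (insert g D)"
    by (rule u_submod) (use insert in auto)
  moreover have "u D \<le> u ((D \<union> A) \<inter> insert g D)" by (rule u_mono) (use insert in auto)
  moreover have "(D \<union> A) \<union> insert g D = D \<union> insert g A" by auto
  ultimately show ?case using insert by simp
qed simp

text \<open>The goods of one bundle together lift \<open>u D\<close> to at least 24, and by
  submodularity they gain at most the sum of their marginals. The bundles are disjoint, and further
  goods of \<open>U\<close> have nonnegative marginals.\<close>

lemma total_marginal:
  assumes "D \<subseteq> {1..m}"
  shows "real (card I) * (24 - u D) \<le> (\<Sum>g\<in>U. u (insert g D) - u D)"
proof -
  have fin: "finite (P l)" if "l \<in> I" for l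
    using that P_sub U_sub by (meson finite_atLeastAtMost finite_subset)
  have "real (card I) * (24 - u D) = (\<Sum>l\<in>I. 24 - u D)" by simp
  also have "\<dots> \<le> (\<Sum>l\<in>I. \<Sum>g\<in>P l. u (insert g D) - u D)"
  proof (rule sum_mono)
    fix l assume l: "l \<in> I"
    then have "P l \<subseteq> {1..m}" using P_sub U_sub by blast
    then have "u (P l) \<le> u (D \<union> P l)" using assms by (intro u_mono) auto
    then show "24 - u D \<le> (\<Sum>g\<in>P l. u (insert g D) - u D)"
      using P_val[OF l] sum_marginals[OF fin[OF l] \<open>P l \<subseteq> {1..m}\<close> assms] by linarith
  qed
  also have "\<dots> = (\<Sum>g\<in>(\<Union>l\<in>I. P l). u (insert g D) - u D)"
    using fin_I fin P_disj by (subst sum.UNION_disjoint) (auto simp: disjoint_family_on_def)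
  also have "\<dots> \<le> (\<Sum>g\<in>U. u (insert g D) - u D)"
  proof (rule sum_mono2)
    show "finite U" using U_sub finite_subset by blast
    fix g assume "g \<in> U - (\<Union>l\<in>I. P l)"
    then show "0 \<le> u (insert g D) - u D" using marginal_nonneg[OF assms] by simp
  qed (use P_sub in auto)
  finally show ?thesis .
qed

text \<open>While \<open>u D < c \<le> 2\<close>, every bundle still offers marginals of total at
  least 24 - 2 = 22. Each marginal \<open>x\<close> lies in the unit interval, so by convexity it
  lowers \<open>psi\<close> by at least \<open>x\<close> times the effect of a full unit. Once
  \<open>u D \<ge> c\<close>, both sides vanish.\<close>

lemma psi_drift:
  assumes "D \<subseteq> {1..m}" "c \<le> 2"
  shows "(\<Sum>g\<in>U. psi c (u (insert g D)) - psi c (u D)) \<le> 22 * real (card I) * (psi (c - 1) (u D) - psi c (u D))"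
proof (cases "u D < c")
  case True
  have neg: "psi (c - 1) (u D) - psi c (u D) \<le> 0"
    using psi_antimono[of "u D" "u D + 1" c] by (simp add: psi_shift)
  have "(\<Sum>g\<in>U. psi c (u (insert g D)) - psi c (u D))
      \<le> (\<Sum>g\<in>U. (u (insert g D) - u D) * (psi (c - 1) (u D) - psi c (u D)))"
  proof (rule sum_mono)
    fix g assume "g \<in> U"
    then show "psi c (u (insert g D)) - psi c (u D) \<le> (u (insert g D) - u D) * (psi (c - 1) (u D) - psi c (u D))"
      using psi_unit_step[of "u (insert g D) - u D" c "u D"] marginal_le_1[OF assms(1), of g] marginal_nonneg[OF assms(1), of g]
      by (simp add: psi_shift)
  qed
  also have "\<dots> = (\<Sum>g\<in>U. u (insert g D) - u D) * (psi (c - 1) (u D) - psi c (u D))"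
    by (simp add: sum_distrib_right)
  also have "\<dots> \<le> (real (card I) * (24 - u D)) * (psi (c - 1) (u D) - psi c (u D))"
    by (rule mult_right_mono_neg[OF total_marginal neg]) (use assms in auto)
  also have "\<dots> \<le> 22 * real (card I) * (psi (c - 1) (u D) - psi c (u D))"
  proof (rule mult_right_mono_neg[OF _ neg])
    have "real (card I) * 22 \<le> real (card I) * (24 - u D)" using True assms by (intro mult_left_mono) auto
    then show "22 * real (card I) \<le> real (card I) * (24 - u D)" by simp
  qed
  finally show ?thesis .
next
  case False
  have "psi c (u (insert g D)) = 1" if "g \<in> U" for g
    using marginal_nonneg[OF assms(1) that] False by (intro psi_eq_1) auto
  then show ?thesis using False by (simp add: psi_eq_1)
qed

end

context agent_view begin

text \<open>The left-hand side is the derivative from \<open>russo_formula\<close>. For a Poisson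
  process of intensity \<open>22 * card I\<close>, run for time \<open>q\<close>, the corresponding
  relation is an equality.\<close>

lemma E_psi_deriv_le:
  assumes "0 \<le> q" "q \<le> 1" "c \<le> 2"
  shows "sub_poly m q (\<lambda>D. \<Sum>g\<in>{1..m}. psi c (u (insert g D \<inter> U)) - psi c (u ((D - {g}) \<inter> U)))
    \<le> 22 * real (card I) * (sub_poly m q (\<lambda>D. psi (c - 1) (u (D \<inter> U))) - sub_poly m q (\<lambda>D. psi c (u (D \<inter> U))))"
proof -
  have "sub_poly m q (\<lambda>D. \<Sum>g\<in>{1..m}. psi c (u (insert g D \<inter> U)) - psi c (u ((D - {g}) \<inter> U)))
    \<le> sub_poly m q (\<lambda>D. 22 * real (card I) * (psi (c - 1) (u (D \<inter> U)) - psi c (u (D \<inter> U))))"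
    unfolding E_sub_eq_sub_poly[OF assms(1,2), symmetric]
  proof (rule E_sub_mono)
    fix D assume D: "D \<subseteq> {1..m}"
    let ?f = "\<lambda>D. psi c (u (D \<inter> U))"
    have "(\<Sum>g\<in>{1..m}. ?f (insert g D) - ?f (D - {g})) = (\<Sum>g\<in>U. ?f (insert g D) - ?f (D - {g}))"
    proof (rule sum.mono_neutral_right)
      show "\<forall>g\<in>{1..m} - U. ?f (insert g D) - ?f (D - {g}) = 0"
      proof
        fix g assume "g \<in> {1..m} - U"
        then have "insert g D \<inter> U = (D - {g}) \<inter> U" by auto
        then show "?f (insert g D) - ?f (D - {g}) = 0" by simp
      qed
    qed (use U_sub in auto)
    also have "\<dots> \<le> (\<Sum>g\<in>U. psi c (u (insert g (D \<inter> U))) - psi c (u (D \<inter> U)))"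
    proof (rule sum_mono)
      fix g assume g: "g \<in> U"
      have ins: "insert g D \<inter> U = insert g (D \<inter> U)" using g by auto
      show "?f (insert g D) - ?f (D - {g}) \<le> psi c (u (insert g (D \<inter> U))) - psi c (u (D \<inter> U))"
      proof (cases "g \<in> D")
        \<comment> \<open>Here the right-hand side is 0 and the left-hand side is not
          positive.\<close>
        case True
        have "u ((D - {g}) \<inter> U) \<le> u (D \<inter> U)" using D by (intro u_mono) auto
        then show ?thesis using psi_antimono ins by fastforce
      next
        case False
        then have "D - {g} = D" by auto
        then show ?thesis using ins by simp
      qed
    qed
    also have "\<dots> \<le> 22 * real (card I) * (psi (c - 1) (u (D \<inter> U)) - psi c (u (D \<inter> U)))"
      by (rule psi_drift) (use D assms in auto)
    finally show "(\<Sum>g\<in>{1..m}. ?f (insert g D) - ?f (D - {g})) \<le> 22 * real (card I) * (psi (c - 1) (u (D \<inter> U)) - psi c (u (D \<inter> U)))" .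
  qed
  also have "\<dots> = 22 * real (card I) * (sub_poly m q (\<lambda>D. psi (c - 1) (u (D \<inter> U))) - sub_poly m q (\<lambda>D. psi c (u (D \<inter> U))))"
    using assms by (simp add: E_sub_eq_sub_poly[symmetric] right_diff_distrib)
  finally show ?thesis .
qed

text \<open>The number of unit steps that \<open>u\<close> makes on a random subset dominates a Poisson variable:
  with rate \<open>y = 22 q (card I)\<close> the right-hand side is the expectation of \<open>psi 2\<close> of such a variable.\<close>

lemma E_psi_le:
  assumes "0 \<le> q" "q \<le> 1"
  defines "y \<equiv> 22 * real (card I) * q"
  shows "E_sub m q (\<lambda>D. psi 2 (u (D \<inter> U))) \<le> 1 + exp (- y) * (exp (3/2) - 1 + y * (exp (3/4) - 1))"
proof -
  define b where "b = 22 * real (card I)"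
  define F where "F = (\<lambda>c q. sub_poly m q (\<lambda>D. psi c (u (D \<inter> U))))"
  define F' where "F' = (\<lambda>c q. sub_poly m q (\<lambda>D. \<Sum>g\<in>{1..m}. psi c (u (insert g D \<inter> U)) - psi c (u ((D - {g}) \<inter> U))))"
  have dF: "(F c has_real_derivative F' c x) (at x)" for c x
    unfolding F_def F'_def using russo_formula[of m "\<lambda>D. psi c (u (D \<inter> U))"] by simp
  have F'_le: "F' c x \<le> b * (F (c - 1) x - F c x)" if "0 \<le> x" "x \<le> 1" "c \<le> 2" for c x
    unfolding F_def F'_def b_def using E_psi_deriv_le[OF that] by simp
  \<comment> \<open>The differential inequalities are triangular in \<open>c\<close>: level 0 is
    constant because \<open>u\<close> is nonnegative, and levels 1 and 2 are then integrated in turn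
    with the integrating factor \<open>exp (b * x)\<close>.\<close>
  have F0: "F 0 x = 1" if "0 \<le> x" "x \<le> 1" for x
  proof -
    have "F 0 x = E_sub m x (\<lambda>_. 1)"
      unfolding F_def E_sub_eq_sub_poly[OF that, symmetric]
      by (rule E_sub_cong) (auto intro!: psi_eq_1 u_nonneg)
    then show ?thesis by simp
  qed
  have start: "F c 0 \<le> exp (3/4 * c)" if "0 \<le> c" for c
  proof -
    have "sub_poly k 0 f = f {}" for k f by (induction k arbitrary: f) simp_all
    then show ?thesis using that u_nonneg[of "{}"] by (simp add: F_def psi_def)
  qed
  have mono1: "exp (b * x) * (F 1 x - 1) \<le> exp (3/4) - 1" if x: "0 \<le> x" "x \<le> 1" for x
  proof -
    have "exp (b * x) * (F 1 x - 1) \<le> exp (b * 0) * (F 1 0 - 1)"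
    proof (rule DERIV_nonpos_imp_nonincreasing[OF x(1)])
      fix t assume t: "0 \<le> t" "t \<le> x"
      have "((\<lambda>t. exp (b * t) * (F 1 t - 1)) has_real_derivative exp (b * t) * (b * (F 1 t - 1) + F' 1 t)) (at t)"
        by (rule derivative_eq_intros dF refl)+ (simp add: algebra_simps)
      moreover have "exp (b * t) * (b * (F 1 t - 1) + F' 1 t) \<le> 0"
        using F'_le[of t 1] F0[of t] t x by (intro mult_nonneg_nonpos) (auto simp: algebra_simps)
      ultimately show "\<exists>y. ((\<lambda>t. exp (b * t) * (F 1 t - 1)) has_real_derivative y) (at t) \<and> y \<le> 0" by blast
    qed
    then show ?thesis using start[of 1] by simp
  qed
  have "exp (b * q) * (F 2 q - 1) - b * q * (exp (3/4) - 1) \<le> exp (b * 0) * (F 2 0 - 1) - b * 0 * (exp (3/4) - 1)"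
  proof (rule DERIV_nonpos_imp_nonincreasing[OF assms(1)])
    fix t assume t: "0 \<le> t" "t \<le> q"
    have "((\<lambda>t. exp (b * t) * (F 2 t - 1) - b * t * (exp (3/4) - 1)) has_real_derivative
        exp (b * t) * (b * (F 2 t - 1) + F' 2 t) - b * (exp (3/4) - 1)) (at t)"
      by (rule derivative_eq_intros dF refl)+ (simp add: algebra_simps)
    moreover have "exp (b * t) * (b * (F 2 t - 1) + F' 2 t) - b * (exp (3/4) - 1) \<le> 0"
    proof -
      have "exp (b * t) * (b * (F 2 t - 1) + F' 2 t) \<le> exp (b * t) * (b * (F 1 t - 1))"
        using F'_le[of t 2] t assms by (intro mult_left_mono) (auto simp: algebra_simps)
      also have "\<dots> = b * (exp (b * t) * (F 1 t - 1))" by simp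
      also have "\<dots> \<le> b * (exp (3/4) - 1)"
        using mono1[of t] t assms by (intro mult_left_mono) (auto simp: b_def)
      finally show ?thesis by simp
    qed
    ultimately show "\<exists>y. ((\<lambda>t. exp (b * t) * (F 2 t - 1) - b * t * (exp (3/4) - 1)) has_real_derivative y) (at t) \<and> y \<le> 0" by blast
  qed
  then have "exp (b * q) * (F 2 q - 1) \<le> exp (3/2) - 1 + b * q * (exp (3/4) - 1)"
    using start[of 2] by simp
  then have "exp (- (b * q)) * (exp (b * q) * (F 2 q - 1)) \<le> exp (- (b * q)) * (exp (3/2) - 1 + b * q * (exp (3/4) - 1))"
    by (rule mult_left_mono) simp
  then have "F 2 q \<le> 1 + exp (- (b * q)) * (exp (3/2) - 1 + b * q * (exp (3/4) - 1))"
    by (simp add: mult.assoc[symmetric] exp_minus_inverse mult.commute)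
  then show ?thesis using assms by (simp add: F_def b_def y_def E_sub_eq_sub_poly)
qed

end

section \<open>Numerical estimates\<close>

lemma exp_numeric_bounds:
  "exp (3/4 :: real) \<le> 2119/1000" "exp (3/2 :: real) \<le> 4491/1000" "exp (4/3 :: real) \<le> 3798/1000"
  "248/10 \<le> exp (55/17 :: real)"
proof -
  have e: "exp 1 < (272/100 :: real)" by (rule e_less_272)
  have "exp (3/4 :: real) ^ 4 = exp 1 ^ 3" by (simp flip: exp_of_nat_mult)
  also have "\<dots> \<le> (272/100) ^ 3" using e by (intro power_mono) auto
  also have "\<dots> \<le> (2119/1000) ^ 4" by (simp add: power_divide)
  finally show 1: "exp (3/4 :: real) \<le> 2119/1000" by (rule power_le_imp_le_base[where n = 3, simplified]) simp
  have "exp (3/2 :: real) = exp (3/4) ^ 2" by (simp flip: exp_of_nat_mult)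
  also have "\<dots> \<le> (2119/1000) ^ 2" using 1 by (intro power_mono) auto
  finally show "exp (3/2 :: real) \<le> 4491/1000" by (simp add: power_divide)
  have "exp (4/3 :: real) ^ 3 = exp 1 ^ 4" by (simp flip: exp_of_nat_mult)
  also have "\<dots> \<le> (272/100) ^ 4" using e by (intro power_mono) auto
  also have "\<dots> \<le> (3798/1000) ^ 3" by (simp add: power_divide)
  finally show "exp (4/3 :: real) \<le> 3798/1000" by (rule power_le_imp_le_base[where n = 2, simplified]) simp
  \<comment> \<open>The lower bound for e comes from 1 + 1/10 + 1/200 = 1105/1000, the Taylor bound
    at 1/10.\<close>
  have "(27/10 :: real) \<le> (1105/1000) ^ 10" by (simp add: power_divide)
  also have "\<dots> \<le> exp (1/10) ^ 10"
    using exp_lower_Taylor_quadratic[of "1/10"] by (intro power_mono) (auto simp: power2_eq_square)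
  also have "\<dots> = exp 1" by (simp flip: exp_of_nat_mult)
  finally have e': "27/10 \<le> exp (1 :: real)" .
  have "(248/10 :: real) ^ 17 \<le> (27/10) ^ 55" by (simp add: power_divide)
  also have "\<dots> \<le> exp 1 ^ 55" using e' by (intro power_mono) auto
  also have "\<dots> = exp (55/17) ^ 17" by (simp flip: exp_of_nat_mult)
  finally show "248/10 \<le> exp (55/17 :: real)" by (rule power_le_imp_le_base[where n = 16, simplified]) simp
qed

text \<open>The rate 55/17 is \<open>22 * card I * \<rho>\<close> for the colouring rate
  \<open>\<rho> = 5 / (34 * card I)\<close>. The growth 35/136 per colour stays below the 9/34 =
  36/136 of \<open>pot2_stuck\<close>; the gap 1/136 makes the sum over the numbers of colours
  converge.\<close>

lemma poisson_value:
  "1 + exp (- (55/17)) * (exp (3/2) - 1 + 55/17 * (exp (3/4) - 1)) \<le> exp (35/136 :: real)"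
proof -
  have "exp (- (55/17)) \<le> (10/248 :: real)"
    using exp_numeric_bounds(4) by (simp add: exp_minus field_simps)
  moreover have "exp (3/2) - 1 + 55/17 * (exp (3/4) - 1) \<le> (7112/1000 :: real)"
  proof -
    have "b - 1 + 55/17 * (a - 1) \<le> 7112/1000" if "a \<le> 2119/1000" "b \<le> 4491/1000" for a b :: real
      using that by (simp add: field_simps)
    then show ?thesis using exp_numeric_bounds(1,2) by blast
  qed
  moreover have "1 \<le> exp (3/2 :: real)" "1 \<le> exp (3/4 :: real)" by simp_all
  ultimately have "exp (- (55/17)) * (exp (3/2) - 1 + 55/17 * (exp (3/4) - 1)) \<le> 10/248 * (7112/1000 :: real)"
    by (intro mult_mono) auto
  moreover have "1 + 35/136 + (35/136)\<^sup>2 / 2 \<le> exp (35/136 :: real)"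
    by (rule exp_lower_Taylor_quadratic) simp
  ultimately show ?thesis by (simp add: power2_eq_square)
qed

section \<open>Random colourings\<close>

text \<open>Expectation over colourings \<open>c\<close>: each good independently gets each colour \<open>k < K\<close> with
  probability \<open>\<rho>\<close> and otherwise the value \<open>K\<close>, which means uncoloured.\<close>

primrec E_col :: "nat \<Rightarrow> real \<Rightarrow> nat \<Rightarrow> ((nat \<Rightarrow> nat) \<Rightarrow> real) \<Rightarrow> real" where
  "E_col K \<rho> 0 f = f (\<lambda>_. K)"
| "E_col K \<rho> (Suc m) f =
    (1 - real K * \<rho>) * E_col K \<rho> m f + \<rho> * (\<Sum>k<K. E_col K \<rho> m (\<lambda>c. f (c(Suc m := k))))"

lemma E_col_mono:
  assumes "0 \<le> \<rho>" "real K * \<rho> \<le> 1"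
    and "\<And>c. (\<And>x. x \<notin> {1..m} \<Longrightarrow> c x = K) \<Longrightarrow> f c \<le> g c"
  shows "E_col K \<rho> m f \<le> E_col K \<rho> m g"
  using assms(3)
proof (induction m arbitrary: f g)
  case (Suc m)
  have "E_col K \<rho> m f \<le> E_col K \<rho> m g"
    by (rule Suc.IH, rule Suc.prems) auto
  moreover have "E_col K \<rho> m (\<lambda>c. f (c(Suc m := k))) \<le> E_col K \<rho> m (\<lambda>c. g (c(Suc m := k)))" for k
    by (rule Suc.IH, rule Suc.prems) auto
  ultimately show ?case using assms(1,2) by (auto intro!: add_mono mult_left_mono sum_mono)
qed auto

lemma E_col_cong:
  assumes "\<And>c. (\<And>x. x \<notin> {1..m} \<Longrightarrow> c x = K) \<Longrightarrow> f c = g c"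
  shows "E_col K \<rho> m f = E_col K \<rho> m g"
  using assms
proof (induction m arbitrary: f g)
  case (Suc m)
  have "E_col K \<rho> m f = E_col K \<rho> m g"
    by (rule Suc.IH, rule Suc.prems) auto
  moreover have "E_col K \<rho> m (\<lambda>c. f (c(Suc m := k))) = E_col K \<rho> m (\<lambda>c. g (c(Suc m := k)))" for k
    by (rule Suc.IH, rule Suc.prems) auto
  ultimately show ?case by simp
qed auto

lemma E_col_add: "E_col K \<rho> m (\<lambda>c. f c + g c) = E_col K \<rho> m f + E_col K \<rho> m g"
  by (induction m arbitrary: f g) (simp_all add: sum.distrib distrib_left)

lemma E_col_cmult: "E_col K \<rho> m (\<lambda>c. a * f c) = a * E_col K \<rho> m f"
proof (induction m arbitrary: f)
  case (Suc m)
  show ?case unfolding E_col.simps Suc.IH by (simp add: sum_distrib_left distrib_left mult.left_commute)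
qed simp

lemma E_col_const [simp]: "E_col K \<rho> m (\<lambda>_. a) = a"
  by (induction m) (simp_all add: algebra_simps)

lemma E_col_sum: "E_col K \<rho> m (\<lambda>c. \<Sum>k\<in>A. f k c) = (\<Sum>k\<in>A. E_col K \<rho> m (f k))"
  by (induction A rule: infinite_finite_induct) (simp_all add: E_col_add)

lemma E_col_class:
  assumes "k < K" "0 \<le> \<rho>" "\<rho> \<le> 1"
  shows "E_col K \<rho> m (\<lambda>c. h {x. c x = k}) = E_sub m \<rho> h"
proof (induction m arbitrary: h)
  case (Suc m)
  have "E_col K \<rho> m (\<lambda>c. h {x. (c(Suc m := i)) x = k})
      = (if i = k then E_sub m \<rho> (\<lambda>D. h (insert (Suc m) D)) else E_sub m \<rho> h)" if "i < K" for i
  proof (cases "i = k")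
    case True
    have "E_col K \<rho> m (\<lambda>c. h {x. (c(Suc m := i)) x = k}) = E_col K \<rho> m (\<lambda>c. h (insert (Suc m) {x. c x = k}))"
    proof (rule E_col_cong)
      fix c :: "nat \<Rightarrow> nat"
      have "{x. (c(Suc m := i)) x = k} = insert (Suc m) {x. c x = k}" using True by auto
      then show "h {x. (c(Suc m := i)) x = k} = h (insert (Suc m) {x. c x = k})" by simp
    qed
    then show ?thesis using True Suc by simp
  next
    case False
    have "E_col K \<rho> m (\<lambda>c. h {x. (c(Suc m := i)) x = k}) = E_col K \<rho> m (\<lambda>c. h {x. c x = k})"
    proof (rule E_col_cong)
      \<comment> \<open>The good \<open>Suc m\<close> is still uncoloured under \<open>c\<close>,
        and \<open>K\<close> differs from \<open>k\<close>, so only the choice \<open>i = k\<close>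
        changes the class.\<close>
      fix c :: "nat \<Rightarrow> nat" assume "\<And>x. x \<notin> {1..m} \<Longrightarrow> c x = K"
      then have "c (Suc m) = K" by simp
      then have "{x. (c(Suc m := i)) x = k} = {x. c x = k}" using False assms(1) by auto
      then show "h {x. (c(Suc m := i)) x = k} = h {x. c x = k}" by simp
    qed
    then show ?thesis using False Suc by simp
  qed
  then have "(\<Sum>i<K. E_col K \<rho> m (\<lambda>c. h {x. (c(Suc m := i)) x = k}))
      = (\<Sum>i<K. E_sub m \<rho> h + (if i = k then E_sub m \<rho> (\<lambda>D. h (insert (Suc m) D)) - E_sub m \<rho> h else 0))"
    by (intro sum.cong) auto
  also have "\<dots> = real K * E_sub m \<rho> h + (E_sub m \<rho> (\<lambda>D. h (insert (Suc m) D)) - E_sub m \<rho> h)"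
    using assms(1) by (simp add: sum.distrib)
  finally have S: "(\<Sum>i<K. E_col K \<rho> m (\<lambda>c. h {x. (c(Suc m := i)) x = k})) = \<dots>" .
  show ?case unfolding E_col.simps S Suc E_sub_Suc[OF assms(2,3)] by (simp add: algebra_simps)
qed (use assms in auto)

text \<open>One good enters at most one class on the left, but each class independently on the
  right. In the induction the new factor is compared using that the product on the right is at most
  the product of the \<open>a k\<close>.\<close>

lemma prod_diff_ge:
  fixes a b :: "nat \<Rightarrow> real"
  assumes "\<And>k. k < K \<Longrightarrow> 0 \<le> b k \<and> b k \<le> a k" "0 \<le> \<rho>" "\<rho> \<le> 1"
  shows "(1 - real K * \<rho>) * (\<Prod>k<K. a k) + \<rho> * (\<Sum>j<K. \<Prod>k<K. if k = j then b k else a k)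
    \<le> (\<Prod>k<K. (1 - \<rho>) * a k + \<rho> * b k)"
  using assms(1)
proof (induction K)
  case (Suc K)
  let ?A = "\<Prod>k<K. a k" and ?S = "\<Sum>j<K. \<Prod>k<K. if k = j then b k else a k"
  let ?X = "\<Prod>k<K. (1 - \<rho>) * a k + \<rho> * b k"
  have IH: "(1 - real K * \<rho>) * ?A + \<rho> * ?S \<le> ?X" using Suc by auto
  have ab: "0 \<le> b K" "b K \<le> a K" using Suc.prems by auto
  have XA: "?X \<le> ?A"
  proof (rule prod_mono)
    fix k assume "k \<in> {..<K}"
    then have "0 \<le> b k" "b k \<le> a k" using Suc.prems by auto
    moreover from this have "\<rho> * b k \<le> \<rho> * a k" "0 \<le> (1 - \<rho>) * a k" "0 \<le> \<rho> * b k"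
      using assms by (auto intro!: mult_left_mono mult_nonneg_nonneg)
    ultimately show "0 \<le> (1 - \<rho>) * a k + \<rho> * b k \<and> (1 - \<rho>) * a k + \<rho> * b k \<le> a k"
      by (simp add: algebra_simps)
  qed
  have A: "(\<Prod>k<K. if k = K then b k else a k) = ?A" by (rule prod.cong) auto
  have S: "(\<Sum>j<K. \<Prod>k<Suc K. if k = j then b k else a k) = a K * ?S"
  proof -
    have "(\<Prod>k<Suc K. if k = j then b k else a k) = a K * (\<Prod>k<K. if k = j then b k else a k)" if "j < K" for j
      using that by simp
    then show ?thesis by (simp add: sum_distrib_left mult.commute)
  qed
  have "(1 - real (Suc K) * \<rho>) * (\<Prod>k<Suc K. a k) + \<rho> * (\<Sum>j<Suc K. \<Prod>k<Suc K. if k = j then b k else a k)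
      = a K * ((1 - real K * \<rho>) * ?A + \<rho> * ?S) - \<rho> * (a K - b K) * ?A"
    unfolding sum.lessThan_Suc S by (simp add: A algebra_simps)
  also have "\<dots> \<le> a K * ?X - \<rho> * (a K - b K) * ?X"
    using IH XA ab assms by (intro diff_mono mult_left_mono) auto
  also have "\<dots> = (\<Prod>k<Suc K. (1 - \<rho>) * a k + \<rho> * b k)" by (simp add: algebra_simps)
  finally show ?case .
qed simp

text \<open>The classes compete for goods, which makes antimonotone functions of distinct classes
  negatively correlated. The goods are exposed one at a time, and \<open>prod_diff_ge\<close>
  settles each of them.\<close>

lemma E_col_negatively_associated:
  assumes "0 \<le> \<rho>" "real K * \<rho> \<le> 1" "\<rho> \<le> 1"
    and "\<And>k S. k < K \<Longrightarrow> 0 \<le> g k S" "\<And>k S T. k < K \<Longrightarrow> S \<subseteq> T \<Longrightarrow> g k T \<le> g k S"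
  shows "E_col K \<rho> m (\<lambda>c. \<Prod>k<K. g k {x. c x = k}) \<le> (\<Prod>k<K. E_sub m \<rho> (g k))"
  using assms(4,5)
proof (induction m arbitrary: g)
  case (Suc m)
  define g1 where "g1 = (\<lambda>k D. g k (insert (Suc m) D))"
  have sub: "E_col K \<rho> m (\<lambda>c. \<Prod>k<K. g k {x. (c(Suc m := j)) x = k})
      \<le> (\<Prod>k<K. if k = j then E_sub m \<rho> (g1 k) else E_sub m \<rho> (g k))" if "j < K" for j
  proof -
    have "E_col K \<rho> m (\<lambda>c. \<Prod>k<K. g k {x. (c(Suc m := j)) x = k})
        = E_col K \<rho> m (\<lambda>c. \<Prod>k<K. (if k = j then g1 k else g k) {x. c x = k})"
    proof (rule E_col_cong)
      fix c :: "nat \<Rightarrow> nat" assume "\<And>x. x \<notin> {1..m} \<Longrightarrow> c x = K"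
      then have c: "c (Suc m) = K" by simp
      have "{x. (c(Suc m := j)) x = k} = (if k = j then insert (Suc m) {x. c x = k} else {x. c x = k})" if "k < K" for k
        using c that by auto
      then show "(\<Prod>k<K. g k {x. (c(Suc m := j)) x = k}) = (\<Prod>k<K. (if k = j then g1 k else g k) {x. c x = k})"
        by (intro prod.cong) (auto simp: g1_def)
    qed
    also have "\<dots> \<le> (\<Prod>k<K. E_sub m \<rho> (if k = j then g1 k else g k))"
    proof (rule Suc.IH)
      show "0 \<le> (if k = j then g1 k else g k) S" if "k < K" for k S
        using Suc.prems(1)[OF that] by (cases "k = j") (auto simp: g1_def)
      show "(if k = j then g1 k else g k) T \<le> (if k = j then g1 k else g k) S" if "k < K" "S \<subseteq> T" for k S T
        using Suc.prems(2)[OF that] Suc.prems(2)[OF that(1) insert_mono[OF that(2)], of "Suc m"] by (auto simp: g1_def)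
    qed
    also have "\<dots> = (\<Prod>k<K. if k = j then E_sub m \<rho> (g1 k) else E_sub m \<rho> (g k))"
      by (rule prod.cong) auto
    finally show ?thesis .
  qed
  have ab: "0 \<le> E_sub m \<rho> (g1 k) \<and> E_sub m \<rho> (g1 k) \<le> E_sub m \<rho> (g k)" if "k < K" for k
    unfolding g1_def
    by (intro conjI integral_nonneg_AE E_sub_mono Suc.prems that) (auto simp: Suc.prems(1)[OF that])
  have "E_col K \<rho> (Suc m) (\<lambda>c. \<Prod>k<K. g k {x. c x = k})
      \<le> (1 - real K * \<rho>) * (\<Prod>k<K. E_sub m \<rho> (g k))
        + \<rho> * (\<Sum>j<K. \<Prod>k<K. if k = j then E_sub m \<rho> (g1 k) else E_sub m \<rho> (g k))"
    unfolding E_col.simps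
    using assms(1,2) Suc.IH[OF Suc.prems] sub by (intro add_mono mult_left_mono sum_mono) auto
  also have "\<dots> \<le> (\<Prod>k<K. (1 - \<rho>) * E_sub m \<rho> (g k) + \<rho> * E_sub m \<rho> (g1 k))"
    by (rule prod_diff_ge) (use ab assms in auto)
  finally show ?case using assms by (simp add: E_sub_Suc g1_def)
qed (use assms in \<open>auto intro!: prod_mono\<close>)

text \<open>Uncolouring each good with probability \<open>r\<close> leaves it with any given colour
  with probability \<open>\<rho> * (1 - r)\<close>, still independently of the others.\<close>

lemma E_col_thin:
  assumes "0 \<le> r" "r \<le> 1"
  shows "E_sub m r (\<lambda>D. E_col K \<rho> m (\<lambda>c. f (\<lambda>x. if x \<in> D then K else c x))) = E_col K (\<rho> * (1 - r)) m f"
proof (induction m arbitrary: f)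
  case (Suc m)
  let ?t = "\<lambda>D c x. if x \<in> D then K else c x"
  have col: "E_col K \<rho> m (\<lambda>c. f (?t D (c(Suc m := k)))) = E_col K \<rho> m (\<lambda>c. f ((?t D c)(Suc m := k)))"
    if "D \<subseteq> {1..m}" for D k
  proof -
    have "?t D (c(Suc m := k)) = (?t D c)(Suc m := k)" for c using that by (auto simp: fun_eq_iff)
    then show ?thesis by simp
  qed
  have IHk: "E_sub m r (\<lambda>D. E_col K \<rho> m (\<lambda>c. f ((?t D c)(Suc m := k))))
      = E_col K (\<rho> * (1 - r)) m (\<lambda>c. f (c(Suc m := k)))" for k
    by (rule Suc.IH)
  have out: "E_sub m r (\<lambda>D. E_col K \<rho> (Suc m) (\<lambda>c. f (?t D c)))
      = (1 - real K * \<rho>) * E_col K (\<rho> * (1 - r)) m f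
        + \<rho> * (\<Sum>k<K. E_col K (\<rho> * (1 - r)) m (\<lambda>c. f (c(Suc m := k))))"
  proof -
    have "E_sub m r (\<lambda>D. E_col K \<rho> (Suc m) (\<lambda>c. f (?t D c)))
      = E_sub m r (\<lambda>D. (1 - real K * \<rho>) * E_col K \<rho> m (\<lambda>c. f (?t D c))
        + \<rho> * (\<Sum>k<K. E_col K \<rho> m (\<lambda>c. f ((?t D c)(Suc m := k)))))"
      by (rule E_sub_cong) (simp add: col)
    also have "\<dots> = (1 - real K * \<rho>) * E_sub m r (\<lambda>D. E_col K \<rho> m (\<lambda>c. f (?t D c)))
        + \<rho> * (\<Sum>k<K. E_sub m r (\<lambda>D. E_col K \<rho> m (\<lambda>c. f ((?t D c)(Suc m := k)))))"
      by simp
    finally show ?thesis unfolding Suc.IH[of f] IHk .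
  qed
  have "E_sub m r (\<lambda>D. E_col K \<rho> (Suc m) (\<lambda>c. f (?t (insert (Suc m) D) c)))
      = E_sub m r (\<lambda>D. E_col K \<rho> m (\<lambda>c. f ((?t D c)(Suc m := K))))"
  proof (rule E_sub_cong)
    fix D :: "nat set"
    have 1: "?t (insert (Suc m) D) c = (?t D c)(Suc m := K)" for c by (auto simp: fun_eq_iff)
    have 2: "?t (insert (Suc m) D) (c(Suc m := k)) = (?t D c)(Suc m := K)" for c k by (auto simp: fun_eq_iff)
    show "E_col K \<rho> (Suc m) (\<lambda>c. f (?t (insert (Suc m) D) c)) = E_col K \<rho> m (\<lambda>c. f ((?t D c)(Suc m := K)))"
      unfolding E_col.simps unfolding 2 unfolding 1 by (simp add: algebra_simps)
  qed
  also have "\<dots> = E_col K (\<rho> * (1 - r)) m (\<lambda>c. f (c(Suc m := K)))" by (rule Suc.IH)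
  also have "\<dots> = E_col K (\<rho> * (1 - r)) m f"
  proof (rule E_col_cong)
    fix c :: "nat \<Rightarrow> nat" assume "\<And>x. x \<notin> {1..m} \<Longrightarrow> c x = K"
    then have "c (Suc m) = K" by simp
    then show "f (c(Suc m := K)) = f c" by (simp add: fun_upd_idem)
  qed
  finally show ?case unfolding E_sub_Suc[OF assms] out by (simp add: algebra_simps)
qed simp

text \<open>Goods are coloured independently, so the colour of \<open>g\<close> may as well be drawn
  last.\<close>

lemma E_col_resample:
  assumes "g \<in> {1..m}"
  shows "E_col K \<rho> m f = E_col K \<rho> m (\<lambda>c. (1 - real K * \<rho>) * f (c(g := K)) + \<rho> * (\<Sum>k<K. f (c(g := k))))"
  using assms
proof (induction m arbitrary: f)
  case (Suc m)
  let ?r = "\<lambda>f c. (1 - real K * \<rho>) * f (c(g := K)) + \<rho> * (\<Sum>k<K. f (c(g := k)))"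
  show ?case
  proof (cases "g = Suc m")
    case True
    have "E_col K \<rho> m f = E_col K \<rho> m (\<lambda>c. f (c(g := K)))"
    proof (rule E_col_cong)
      fix c :: "nat \<Rightarrow> nat" assume "\<And>x. x \<notin> {1..m} \<Longrightarrow> c x = K"
      then have "c g = K" using True by simp
      then show "f c = f (c(g := K))" by (simp add: fun_upd_idem)
    qed
    then have 1: "E_col K \<rho> (Suc m) f = E_col K \<rho> m (?r f)"
      by (simp add: True E_col_add E_col_cmult E_col_sum)
    have 2: "?r f (c(Suc m := k)) = ?r f c" for c k by (simp add: True)
    have "E_col K \<rho> (Suc m) (?r f) = E_col K \<rho> m (?r f)"
      unfolding E_col.simps 2 by (simp add: algebra_simps)
    with 1 show ?thesis by (rule trans[OF _ sym])
  next
    case False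
    then have g: "g \<in> {1..m}" using Suc.prems by auto
    have h: "E_col K \<rho> m (\<lambda>c. ?r f (c(Suc m := k))) = E_col K \<rho> m (\<lambda>c. f (c(Suc m := k)))" for k
      using Suc.IH[OF g, of "\<lambda>c. f (c(Suc m := k))"] unfolding fun_upd_twist[OF False] by (rule sym)
    show ?thesis unfolding E_col.simps h Suc.IH[OF g, of f, symmetric] ..
  qed
qed simp

section \<open>Closure properties of increasing supermodular functions\<close>

definition increasing :: "(nat set \<Rightarrow> real) \<Rightarrow> bool" where
  "increasing G \<longleftrightarrow> 0 \<le> G {} \<and> (\<forall>A B. A \<subseteq> B \<longrightarrow> G A \<le> G B)"

lemma increasing_nonneg: "increasing G \<Longrightarrow> 0 \<le> G A"
  unfolding increasing_def by (meson empty_subsetI order_trans)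

lemma increasingD: "increasing G \<Longrightarrow> A \<subseteq> B \<Longrightarrow> G A \<le> G B"
  unfolding increasing_def by blast

lemma increasing_mult:
  "increasing F \<Longrightarrow> increasing G \<Longrightarrow> increasing (\<lambda>D. F D * G D)"
  by (auto simp: increasing_def intro!: mult_mono intro: increasing_nonneg[unfolded increasing_def])

text \<open>Measure all values from those at \<open>A \<inter> B\<close>: the value at the union is
  at least the base plus both increments. Multiplying these bounds for \<open>F\<close> and
  \<open>G\<close> leaves only nonnegative cross terms in excess.\<close>

lemma supermodular_mult:
  assumes "increasing F" "increasing G" "supermodular F" "supermodular G"
  shows "supermodular (\<lambda>D. F D * G D)"
  unfolding supermodular_def
proof safe
  fix A B :: "nat set"
  have F: "F (A \<inter> B) \<le> F A" "F (A \<inter> B) \<le> F B" "0 \<le> F (A \<inter> B)"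
    and G: "G (A \<inter> B) \<le> G A" "G (A \<inter> B) \<le> G B" "0 \<le> G (A \<inter> B)"
    using assms increasingD increasing_nonneg by auto
  have "(F A + F B - F (A \<inter> B)) * (G A + G B - G (A \<inter> B)) \<le> F (A \<union> B) * G (A \<union> B)"
    using assms(3,4) F G increasing_nonneg[OF assms(1)]
    by (intro mult_mono) (auto simp: supermodular_def algebra_simps)
  moreover have "0 \<le> (F A - F (A \<inter> B)) * (G B - G (A \<inter> B)) + (F B - F (A \<inter> B)) * (G A - G (A \<inter> B))"
    using F G by (intro add_nonneg_nonneg mult_nonneg_nonneg) auto
  ultimately show "F A * G A + F B * G B \<le> F (A \<union> B) * G (A \<union> B) + F (A \<inter> B) * G (A \<inter> B)"
    by (simp add: algebra_simps)
qed

lemma supermodular_increasing_prod: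
  fixes K :: nat
  assumes "\<And>k. k < K \<Longrightarrow> increasing (G k) \<and> supermodular (G k)"
  shows "increasing (\<lambda>D. \<Prod>k<K. G k D) \<and> supermodular (\<lambda>D. \<Prod>k<K. G k D)"
  using assms
proof (induction K)
  case (Suc K)
  then show ?case by (simp add: increasing_mult supermodular_mult)
qed (simp add: increasing_def supermodular_def)

lemma supermodular_increasing_E_col:
  assumes "0 \<le> \<rho>" "real K * \<rho> \<le> 1"
    and "\<And>c. increasing (\<lambda>D. G D c) \<and> supermodular (\<lambda>D. G D c)"
  shows "increasing (\<lambda>D. E_col K \<rho> m (G D)) \<and> supermodular (\<lambda>D. E_col K \<rho> m (G D))"
proof
  have "0 \<le> E_col K \<rho> m (G {})"
    using E_col_mono[OF assms(1,2), of m "\<lambda>_. 0" "G {}"] assms(3) by (auto simp: increasing_def)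
  moreover have "E_col K \<rho> m (G A) \<le> E_col K \<rho> m (G B)" if "A \<subseteq> B" for A B
    using assms(3) that by (intro E_col_mono[OF assms(1,2)]) (auto simp: increasing_def)
  ultimately show "increasing (\<lambda>D. E_col K \<rho> m (G D))" by (simp add: increasing_def)
  show "supermodular (\<lambda>D. E_col K \<rho> m (G D))"
    unfolding supermodular_def
  proof safe
    fix A B
    show "E_col K \<rho> m (G A) + E_col K \<rho> m (G B) \<le> E_col K \<rho> m (G (A \<union> B)) + E_col K \<rho> m (G (A \<inter> B))"
      unfolding E_col_add[symmetric]
      using assms(3) by (intro E_col_mono[OF assms(1,2)]) (auto simp: supermodular_def)
  qed
qed

text \<open>With \<open>i\<close> goods of \<open>Y\<close> in both sets and \<open>a\<close>,
  \<open>b\<close> further ones in either, this is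
  \<open>(x ^ a - 1) * (x ^ b - 1) \<ge> 0\<close>.\<close>

lemma supermodular_power_card:
  assumes "finite Y" "1 \<le> x"
  shows "increasing (\<lambda>D. x ^ card (Y \<inter> D)) \<and> supermodular (\<lambda>D. x ^ card (Y \<inter> D))"
proof
  have mono: "card (Y \<inter> A) \<le> card (Y \<inter> B)" if "A \<subseteq> B" for A B
    using that assms by (intro card_mono) auto
  then show "increasing (\<lambda>D. x ^ card (Y \<inter> D))"
    using assms by (auto simp: increasing_def intro!: power_increasing)
  show "supermodular (\<lambda>D. x ^ card (Y \<inter> D))"
    unfolding supermodular_def
  proof safe
    fix A B
    define i where "i = card (Y \<inter> (A \<inter> B))"
    define a where "a = card (Y \<inter> A) - i"
    define b where "b = card (Y \<inter> B) - i"
    have ia: "card (Y \<inter> A) = i + a" "card (Y \<inter> B) = i + b"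
      using mono[of "A \<inter> B"] by (auto simp: a_def b_def i_def)
    have "card (Y \<inter> A) + card (Y \<inter> B) = card ((Y \<inter> A) \<union> (Y \<inter> B)) + card ((Y \<inter> A) \<inter> (Y \<inter> B))"
      using assms by (intro card_Un_Int) auto
    moreover have "(Y \<inter> A) \<union> (Y \<inter> B) = Y \<inter> (A \<union> B)" "(Y \<inter> A) \<inter> (Y \<inter> B) = Y \<inter> (A \<inter> B)" by auto
    ultimately have un: "card (Y \<inter> (A \<union> B)) = i + a + b" using ia by (simp add: i_def)
    have "0 \<le> x ^ i * ((x ^ a - 1) * (x ^ b - 1))"
      using assms by (intro mult_nonneg_nonneg) auto
    then show "x ^ card (Y \<inter> A) + x ^ card (Y \<inter> B) \<le> x ^ card (Y \<inter> (A \<union> B)) + x ^ card (Y \<inter> (A \<inter> B))"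
      unfolding ia un i_def[symmetric] by (simp add: power_add algebra_simps)
  qed
qed

section \<open>The colouring potential\<close>

context agent_view begin

lemma psi_supermodular:
  assumes "S \<subseteq> {1..m}"
  shows "increasing (\<lambda>D. psi c (u (S - D))) \<and> supermodular (\<lambda>D. psi c (u (S - D)))"
proof
  show "increasing (\<lambda>D. psi c (u (S - D)))"
    unfolding increasing_def using assms by (auto intro!: psi_antimono u_mono)
  show "supermodular (\<lambda>D. psi c (u (S - D)))"
    unfolding supermodular_def
  proof safe
    fix A B
    have "(S - A) \<union> (S - B) = S - (A \<inter> B)" "(S - A) \<inter> (S - B) = S - (A \<union> B)" by auto
    then have "u (S - A \<inter> B) + u (S - (A \<union> B)) \<le> u (S - A) + u (S - B)"
      using u_submod[of "S - A" "S - B"] assms by auto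
    moreover have "u (S - (A \<union> B)) \<le> u (S - A)" "u (S - (A \<union> B)) \<le> u (S - B)"
      "u (S - A) \<le> u (S - A \<inter> B)" "u (S - B) \<le> u (S - A \<inter> B)"
      using assms by (auto intro!: u_mono)
    ultimately show "psi c (u (S - A)) + psi c (u (S - B)) \<le> psi c (u (S - (A \<union> B))) + psi c (u (S - A \<inter> B))"
      using psi_crossing[of "u (S - (A \<union> B))" "u (S - A)" "u (S - B)" "u (S - A \<inter> B)" c] by simp
  qed
qed

text \<open>The product is the exponential of 3/4 times the total shortfall of the colour classes
  below 2 units.\<close>

definition col_val :: "nat \<Rightarrow> nat set \<Rightarrow> (nat \<Rightarrow> nat) \<Rightarrow> real" where
  "col_val K R c = (\<Prod>k<K. psi 2 (u ({x. c x = k} \<inter> U \<inter> R)))"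

definition col_pot :: "nat \<Rightarrow> real \<Rightarrow> nat set \<Rightarrow> real" where
  "col_pot K \<rho> R = E_col K \<rho> m (col_val K R)"

lemma inter_U: "X \<inter> U \<inter> R \<subseteq> {1..m}" using U_sub by auto

lemma col_pot_supermodular:
  assumes "0 \<le> \<rho>" "real K * \<rho> \<le> 1"
  shows "increasing (\<lambda>D. col_pot K \<rho> (R - D)) \<and> supermodular (\<lambda>D. col_pot K \<rho> (R - D))"
  unfolding col_pot_def
proof (rule supermodular_increasing_E_col[OF assms])
  fix c :: "nat \<Rightarrow> nat"
  have "{x. c x = k} \<inter> U \<inter> (R - D) = ({x. c x = k} \<inter> U \<inter> R) - D" for k D by auto
  then show "increasing (\<lambda>D. col_val K (R - D) c) \<and> supermodular (\<lambda>D. col_val K (R - D) c)"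
    unfolding col_val_def using supermodular_increasing_prod psi_supermodular inter_U by simp
qed

lemma col_pot_nonneg: "0 \<le> \<rho> \<Longrightarrow> real K * \<rho> \<le> 1 \<Longrightarrow> 0 \<le> col_pot K \<rho> R"
  using increasing_nonneg[of "\<lambda>D. col_pot K \<rho> (R - D)" "{}"] col_pot_supermodular[of \<rho> K R] by simp

lemma col_pot_thin:
  assumes "0 \<le> r" "r \<le> 1"
  shows "E_sub m r (\<lambda>D. col_pot K \<rho> (R - D)) = col_pot K (\<rho> * (1 - r)) R"
proof -
  have "col_val K (R - D) c = col_val K R (\<lambda>x. if x \<in> D then K else c x)" for D and c :: "nat \<Rightarrow> nat"
    unfolding col_val_def
  proof (rule prod.cong)
    fix k assume "k \<in> {..<K}"
    then have "{x. c x = k} \<inter> U \<inter> (R - D) = {x. (if x \<in> D then K else c x) = k} \<inter> U \<inter> R" by auto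
    then show "psi 2 (u ({x. c x = k} \<inter> U \<inter> (R - D))) = psi 2 (u ({x. (if x \<in> D then K else c x) = k} \<inter> U \<inter> R))"
      by simp
  qed simp
  then have "col_val K (R - D) = (\<lambda>c. col_val K R (\<lambda>x. if x \<in> D then K else c x))" for D by blast
  then show ?thesis unfolding col_pot_def using E_col_thin[OF assms] by simp
qed

lemma col_pot_start:
  assumes "0 \<le> \<rho>" "real K * \<rho> \<le> 1" "\<rho> \<le> 1"
  shows "col_pot K \<rho> R \<le> E_sub m \<rho> (\<lambda>D. psi 2 (u (D \<inter> U \<inter> R))) ^ K"
proof -
  have "col_pot K \<rho> R \<le> (\<Prod>k<K. E_sub m \<rho> (\<lambda>D. psi 2 (u (D \<inter> U \<inter> R))))"
    unfolding col_pot_def col_val_def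
    by (rule E_col_negatively_associated[OF assms, where g = "\<lambda>k D. psi 2 (u (D \<inter> U \<inter> R))"])
      (auto intro!: psi_antimono u_mono inter_U)
  then show ?thesis by simp
qed

lemma exp_tangent: "exp a * (1 + (x - a)) \<le> exp (x::real)"
proof -
  have "exp a * (1 + (x - a)) \<le> exp a * exp (x - a)"
    by (intro mult_left_mono) (auto simp: add.commute)
  then show ?thesis by (simp add: exp_diff)
qed

text \<open>Jensen's inequality, by way of the tangent of the exponential at the mean. Each class is
  distributed as a random subset, so the mean total shortfall is \<open>K\<close> times that of one
  class.\<close>

lemma col_pot_lower:
  assumes "0 \<le> \<rho>" "real K * \<rho> \<le> 1" "\<rho> \<le> 1"
  shows "exp (3/4 * real K * E_sub m \<rho> (\<lambda>D. max 0 (2 - u (D \<inter> U \<inter> R)))) \<le> col_pot K \<rho> R"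
proof -
  define h where "h = (\<lambda>D. max 0 (2 - u (D \<inter> U \<inter> R)))"
  define X where "X = (\<lambda>c :: nat \<Rightarrow> nat. \<Sum>k<K. 3/4 * h {x. c x = k})"
  define a where "a = 3/4 * real K * E_sub m \<rho> h"
  have "E_col K \<rho> m X = (\<Sum>k<K. 3/4 * E_sub m \<rho> h)"
    unfolding X_def E_col_sum E_col_cmult using assms by (intro sum.cong) (auto simp: E_col_class)
  then have X: "E_col K \<rho> m X = a" by (simp add: a_def)
  have "E_col K \<rho> m (\<lambda>c. exp a * (1 - a) + exp a * X c) = exp a * (1 - a) + exp a * a"
    unfolding E_col_add E_col_cmult E_col_const X ..
  then have "exp a = E_col K \<rho> m (\<lambda>c. exp a * (1 - a) + exp a * X c)" by (simp add: algebra_simps)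
  also have "\<dots> \<le> E_col K \<rho> m (\<lambda>c. exp (X c))"
  proof (intro E_col_mono assms)
    show "exp a * (1 - a) + exp a * X c \<le> exp (X c)" for c
      using exp_tangent[of a "X c"] by (simp add: algebra_simps)
  qed
  also have "(\<lambda>c. exp (X c)) = col_val K R"
    by (rule ext) (simp add: col_val_def X_def h_def psi_def exp_sum)
  finally show ?thesis unfolding a_def h_def col_pot_def .
qed

lemma psi_add_1: "exp (- 3/4) * psi c z \<le> psi c (z + 1)"
proof -
  have "exp (- 3/4) * psi c z = exp (- 3/4 + 3/4 * max 0 (c - z))"
    unfolding psi_def exp_add ..
  also have "\<dots> \<le> psi c (z + 1)"
    unfolding psi_def exp_le_cancel_iff by (simp add: max_def)
  finally show ?thesis .
qed

text \<open>The good \<open>g\<close> is coloured with probability \<open>K * \<rho>\<close>. If so,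
  its loss costs at most a factor \<open>exp (3/4)\<close>, since its marginal is at most 1;
  otherwise it costs nothing. Convexity of the exponential merges the two cases.\<close>

lemma col_pot_remove:
  assumes "0 \<le> \<rho>" "real K * \<rho> \<le> 1" "g \<in> U" "g \<in> R"
  shows "col_pot K \<rho> (R - {g}) \<le> exp (3/4 * real K * \<rho>) * col_pot K \<rho> R"
proof -
  have g: "g \<in> {1..m}" using assms U_sub by auto
  let ?c = "\<lambda>c. col_val K (R - {g}) c"
  have nn: "0 \<le> ?c c" for c unfolding col_val_def by (intro prod_nonneg) simp
  have drop: "col_val K R (c(g := K)) = ?c c" for c
    unfolding col_val_def
  proof (rule prod.cong)
    fix k assume "k \<in> {..<K}"
    then have "{x. (c(g := K)) x = k} \<inter> U \<inter> R = {x. c x = k} \<inter> U \<inter> (R - {g})" by auto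
    then show "psi 2 (u ({x. (c(g := K)) x = k} \<inter> U \<inter> R)) = psi 2 (u ({x. c x = k} \<inter> U \<inter> (R - {g})))" by simp
  qed simp
  have put: "exp (- 3/4) * ?c c \<le> col_val K R (c(g := j))" if j: "j < K" for c j
  proof -
    have "(\<Prod>k<K. (if k = j then exp (- 3/4) else 1) * psi 2 (u ({x. c x = k} \<inter> U \<inter> (R - {g}))))
        \<le> col_val K R (c(g := j))"
      unfolding col_val_def
    proof (rule prod_mono, intro conjI)
      fix k
      show "(if k = j then exp (- 3/4) else 1) * psi 2 (u ({x. c x = k} \<inter> U \<inter> (R - {g})))
          \<le> psi 2 (u ({x. (c(g := j)) x = k} \<inter> U \<inter> R))"
      proof (cases "k = j")
        case True
        let ?X = "{x. c x = k} \<inter> U \<inter> (R - {g})"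
        have "{x. (c(g := j)) x = k} \<inter> U \<inter> R = insert g ?X" using True assms by auto
        moreover have "u (insert g ?X) \<le> u ?X + 1" by (rule marginal_le_1) (use inter_U assms in auto)
        ultimately show ?thesis
          using psi_add_1[of 2 "u ?X"] psi_antimono[of "u (insert g ?X)" "u ?X + 1" 2] True by simp
      next
        case False
        then have "{x. (c(g := j)) x = k} \<inter> U \<inter> R = {x. c x = k} \<inter> U \<inter> (R - {g})" by auto
        then show ?thesis using False by simp
      qed
    qed auto
    also have "(\<Prod>k<K. (if k = j then exp (- 3/4) else 1) * psi 2 (u ({x. c x = k} \<inter> U \<inter> (R - {g}))))
        = exp (- 3/4) * ?c c"
      unfolding prod.distrib col_val_def using j by simp
    finally show ?thesis .
  qed
  have conv: "exp (- (3/4 * (real K * \<rho>))) \<le> 1 - real K * \<rho> + real K * \<rho> * exp (- 3/4)"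
    using convex_onD[OF exp_convex, of "real K * \<rho>" 0 "- 3/4"] assms by (simp add: algebra_simps)
  have "exp (- (3/4 * (real K * \<rho>))) * col_pot K \<rho> (R - {g})
      = E_col K \<rho> m (\<lambda>c. exp (- (3/4 * (real K * \<rho>))) * ?c c)"
    by (simp add: col_pot_def E_col_cmult)
  also have "\<dots> \<le> E_col K \<rho> m (\<lambda>c. (1 - real K * \<rho>) * col_val K R (c(g := K)) + \<rho> * (\<Sum>k<K. col_val K R (c(g := k))))"
  proof (rule E_col_mono[OF assms(1,2)])
    fix c :: "nat \<Rightarrow> nat"
    have "exp (- (3/4 * (real K * \<rho>))) * ?c c \<le> (1 - real K * \<rho> + real K * \<rho> * exp (- 3/4)) * ?c c"
      by (rule mult_right_mono[OF conv nn])
    also have "\<dots> = (1 - real K * \<rho>) * ?c c + \<rho> * (\<Sum>k<K. exp (- 3/4) * ?c c)" by (simp add: algebra_simps)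
    also have "\<dots> \<le> (1 - real K * \<rho>) * col_val K R (c(g := K)) + \<rho> * (\<Sum>k<K. col_val K R (c(g := k)))"
      unfolding drop using assms put by (intro add_mono mult_left_mono sum_mono) auto
    finally show "exp (- (3/4 * (real K * \<rho>))) * ?c c
      \<le> (1 - real K * \<rho>) * col_val K R (c(g := K)) + \<rho> * (\<Sum>k<K. col_val K R (c(g := k)))" .
  qed
  also have "\<dots> = col_pot K \<rho> R"
    unfolding col_pot_def by (rule E_col_resample[OF g, symmetric])
  finally have "exp (3/4 * (real K * \<rho>)) * (exp (- (3/4 * (real K * \<rho>))) * col_pot K \<rho> (R - {g}))
      \<le> exp (3/4 * (real K * \<rho>)) * col_pot K \<rho> R"
    by (rule mult_left_mono) simp
  then show ?thesis by (simp add: mult.assoc[symmetric] exp_minus_inverse)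
qed

end

section \<open>The algorithm and its trajectory\<close>

text \<open>Rejection sampling from draws made in advance, so that \<open>a\<close> carries all the
  randomness.\<close>

primrec first_good :: "real \<Rightarrow> valuation \<Rightarrow> nat set \<Rightarrow> nat set list \<Rightarrow> nat set" where
  "first_good \<theta> w R [] = {}"
| "first_good \<theta> w R (S # a) = (if \<theta> \<le> w (S \<inter> R) then S \<inter> R else first_good \<theta> w R a)"

text \<open>This test uses no coins: it depends only on the revealed valuation and the remaining
  goods.\<close>

definition samplable :: "nat \<Rightarrow> real \<Rightarrow> real \<Rightarrow> valuation \<Rightarrow> nat set \<Rightarrow> bool" where
  "samplable m q \<theta> w R \<longleftrightarrow> 1/2 \<le> measure_pmf.prob (random_subset m q) {S. \<theta> \<le> w (S \<inter> R)}"

definition pick :: "nat \<Rightarrow> real \<Rightarrow> real \<Rightarrow> valuation \<Rightarrow> nat set \<Rightarrow> nat set list \<Rightarrow> nat set" where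
  "pick m q \<theta> w R a =
    (if \<exists>g\<in>R. \<theta> \<le> w {g} then {SOME g. g \<in> R \<and> \<theta> \<le> w {g}}
     else if samplable m q \<theta> w R then first_good \<theta> w R a else {})"

lemma first_good_subset: "first_good \<theta> w R a \<subseteq> R"
  by (induction a) auto

lemma first_good_value: "\<exists>S\<in>set a. \<theta> \<le> w (S \<inter> R) \<Longrightarrow> \<theta> \<le> w (first_good \<theta> w R a)"
  by (induction a) auto

lemma pick_large:
  assumes "\<exists>g\<in>R. \<theta> \<le> w {g}"
  obtains g where "g \<in> R" "\<theta> \<le> w {g}" "\<And>a. pick m q \<theta> w R a = {g}"
proof -
  define g where "g = (SOME g. g \<in> R \<and> \<theta> \<le> w {g})"
  have "g \<in> R \<and> \<theta> \<le> w {g}" unfolding g_def by (rule someI_ex) (use assms in auto)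
  then show thesis using that assms by (auto simp: pick_def g_def)
qed

lemma pick_subset: "pick m q \<theta> w R a \<subseteq> R"
proof (cases "\<exists>g\<in>R. \<theta> \<le> w {g}")
  case True
  then show ?thesis by (metis pick_large empty_subsetI insert_subset)
qed (auto simp: pick_def dest: subsetD[OF first_good_subset])

abbreviation attempts :: "nat \<Rightarrow> nat \<Rightarrow> real \<Rightarrow> nat set list pmf" where
  "attempts m T q \<equiv> replicate_pmf T (random_subset m q)"

lemma finite_attempts [simp]: "finite (set_pmf (attempts m T q))"
  by (induction T) auto

lemma expectation_attempts_Suc:
  "measure_pmf.expectation (attempts m (Suc T) q) f
    = E_sub m q (\<lambda>S. measure_pmf.expectation (attempts m T q) (\<lambda>a. f (S # a)))"
  for f :: "nat set list \<Rightarrow> real"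
  by (simp add: expectation_bind_finite del: integral_measure_pmf)

text \<open>Conditioning on success at most doubles the expected increase of \<open>G\<close>, and for supermodular
  \<open>G\<close> this is no more than doubling the sampling rate.\<close>

lemma first_good_dominated:
  assumes "increasing G" "supermodular G" "0 \<le> q" "2 * q \<le> 1" "samplable m q \<theta> w R"
  shows "measure_pmf.expectation (attempts m T q) (\<lambda>a. G (first_good \<theta> w R a)) \<le> E_sub m (2 * q) G"
proof -
  define A where "A = {S. \<theta> \<le> w (S \<inter> R)}"
  define d where "d = E_sub m q G - G {}"
  have inc: "G {} \<le> G S" for S using assms(1) by (auto simp: increasing_def)
  have "G {} \<le> E_sub m q G" using E_sub_mono[of m "\<lambda>_. G {}" G q] inc by simp
  then have d: "0 \<le> d" by (simp add: d_def)
  define p where "p = E_sub m q (indicator A)"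
  have p: "1/2 \<le> p" using assms(5) by (simp add: p_def A_def samplable_def)
  have "measure_pmf.expectation (attempts m T q) (\<lambda>a. G (first_good \<theta> w R a)) \<le> G {} + 2 * d"
  proof (induction T)
    case (Suc T)
    define e where "e = measure_pmf.expectation (attempts m T q) (\<lambda>a. G (first_good \<theta> w R a))"
    have "measure_pmf.expectation (attempts m (Suc T) q) (\<lambda>a. G (first_good \<theta> w R a))
        = E_sub m q (\<lambda>S. if S \<in> A then G (S \<inter> R) else e)"
      unfolding expectation_attempts_Suc e_def by (rule E_sub_cong) (simp add: A_def)
    \<comment> \<open>A success yields at most \<open>G S\<close>; a failure falls under the
      inductive bound. The increment of \<open>G S\<close> over \<open>G {}\<close> is charged in
      both cases, and the probability \<open>1 - p \<le> 1/2\<close> of failure halves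
      \<open>2 * d\<close>.\<close>
    also have "\<dots> \<le> E_sub m q (\<lambda>S. (G S - G {}) + G {} + (1 - indicator A S) * (2 * d))"
    proof (rule E_sub_mono)
      fix S
      have "G (S \<inter> R) \<le> G S" by (rule increasingD[OF assms(1)]) auto
      then show "(if S \<in> A then G (S \<inter> R) else e) \<le> (G S - G {}) + G {} + (1 - indicator A S) * (2 * d)"
        using Suc inc[of S] by (auto simp: e_def)
    qed
    also have "\<dots> = d + G {} + (1 - p) * (2 * d)"
      by (simp add: d_def p_def algebra_simps)
    also have "\<dots> \<le> G {} + 2 * d"
      using mult_right_mono[OF p d] by (simp add: algebra_simps)
    finally show ?case .
  qed (use d in simp)
  then show ?thesis using E_sub_double_rate[OF assms(2,3,4), of m] by (simp add: d_def)
qed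

lemma prob_all_attempts_fail:
  assumes "samplable m q \<theta> w R"
  shows "measure_pmf.expectation (attempts m T q) (\<lambda>a. of_bool (\<forall>S\<in>set a. \<not> \<theta> \<le> w (S \<inter> R))) \<le> (1/2 :: real) ^ T"
proof (induction T)
  case (Suc T)
  define A where "A = {S. \<theta> \<le> w (S \<inter> R)}"
  define e where "e = measure_pmf.expectation (attempts m T q) (\<lambda>a. of_bool (\<forall>S\<in>set a. \<not> \<theta> \<le> w (S \<inter> R)) :: real)"
  have "measure_pmf.expectation (attempts m (Suc T) q) (\<lambda>a. of_bool (\<forall>S\<in>set a. \<not> \<theta> \<le> w (S \<inter> R)))
      = E_sub m q (\<lambda>S. (1 - indicator A S) * e)"
    unfolding expectation_attempts_Suc e_def
  proof (rule E_sub_cong)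
    fix S
    show "measure_pmf.expectation (attempts m T q) (\<lambda>a. of_bool (\<forall>S'\<in>set (S # a). \<not> \<theta> \<le> w (S' \<inter> R)))
      = (1 - indicator A S) * measure_pmf.expectation (attempts m T q) (\<lambda>a. of_bool (\<forall>S\<in>set a. \<not> \<theta> \<le> w (S \<inter> R)) :: real)"
      by (cases "\<theta> \<le> w (S \<inter> R)") (simp_all add: A_def)
  qed
  also have "\<dots> = (1 - measure_pmf.prob (random_subset m q) A) * e"
    by (simp add: algebra_simps)
  also have "\<dots> \<le> 1/2 * (1/2) ^ T"
    using assms Suc unfolding samplable_def e_def[symmetric] A_def[symmetric]
    by (intro mult_mono) (auto simp: e_def intro!: integral_nonneg_AE)
  finally show ?case by simp
qed simp

section \<open>Independent seeds and expectations along a trajectory\<close>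

primrec seeds :: "(nat \<Rightarrow> 'a pmf) \<Rightarrow> nat \<Rightarrow> (nat \<Rightarrow> 'a) pmf" where
  "seeds A 0 = return_pmf (\<lambda>_. undefined)"
| "seeds A (Suc i) = bind_pmf (seeds A i) (\<lambda>\<omega>. map_pmf (fun_upd \<omega> i) (A i))"

primrec trace :: "(nat \<Rightarrow> 'a \<Rightarrow> 's \<Rightarrow> 's) \<Rightarrow> 's \<Rightarrow> (nat \<Rightarrow> 'a) \<Rightarrow> nat \<Rightarrow> 's" where
  "trace f s \<omega> 0 = s"
| "trace f s \<omega> (Suc i) = f i (\<omega> i) (trace f s \<omega> i)"

lemma trace_cong: "(\<And>i. i < j \<Longrightarrow> \<omega> i = \<omega>' i) \<Longrightarrow> trace f s \<omega> j = trace f s \<omega>' j"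
  by (induction j) auto

lemma finite_seeds [simp]: "(\<And>i. finite (set_pmf (A i))) \<Longrightarrow> finite (set_pmf (seeds A n))"
  by (induction n) auto

lemma expectation_seeds_Suc:
  fixes g :: "(nat \<Rightarrow> 'a) \<Rightarrow> real"
  assumes "\<And>i. finite (set_pmf (A i))"
  shows "measure_pmf.expectation (seeds A (Suc i)) g
    = measure_pmf.expectation (seeds A i) (\<lambda>\<omega>. measure_pmf.expectation (A i) (\<lambda>a. g (fun_upd \<omega> i a)))"
  using assms by (simp add: expectation_bind_finite)

lemma expectation_seeds_prefix:
  fixes g :: "(nat \<Rightarrow> 'a) \<Rightarrow> real"
  assumes "\<And>i. finite (set_pmf (A i))" "j \<le> n"
    and "\<And>\<omega> \<omega>'. (\<And>i. i < j \<Longrightarrow> \<omega> i = \<omega>' i) \<Longrightarrow> g \<omega> = g \<omega>'"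
  shows "measure_pmf.expectation (seeds A n) g = measure_pmf.expectation (seeds A j) g"
  using assms(2)
proof (induction n rule: dec_induct)
  case (step n)
  have "g (fun_upd \<omega> n a) = g \<omega>" for \<omega> a by (rule assms(3)) (use step in auto)
  then show ?case using step assms(1) by (simp add: expectation_seeds_Suc del: seeds.simps)
qed simp

text \<open>The supermartingale bound with an additive error at each step, obtained by conditioning
  on the earlier seeds.\<close>

lemma expectation_trace_le:
  fixes V :: "nat \<Rightarrow> 's \<Rightarrow> real"
  assumes fin: "\<And>i. finite (set_pmf (A i))"
    and inv0: "Inv s" and inv: "\<And>i a s. i < j \<Longrightarrow> Inv s \<Longrightarrow> Inv (f i a s)"
    and step: "\<And>i s. i < j \<Longrightarrow> Inv s \<Longrightarrow> measure_pmf.expectation (A i) (\<lambda>a. V (Suc i) (f i a s)) \<le> V i s + e i"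
  shows "measure_pmf.expectation (seeds A j) (\<lambda>\<omega>. V j (trace f s \<omega> j)) \<le> V 0 s + (\<Sum>i<j. e i)"
  using inv step
proof (induction j)
  case (Suc j)
  have inv_trace: "Inv (trace f s \<omega> i)" if "i \<le> j" for i \<omega>
    using that by (induction i) (auto simp: inv0 Suc.prems(1))
  have tr: "trace f s (fun_upd \<omega> j a) j = trace f s \<omega> j" for \<omega> a by (rule trace_cong) auto
  have "measure_pmf.expectation (seeds A (Suc j)) (\<lambda>\<omega>. V (Suc j) (trace f s \<omega> (Suc j)))
      = measure_pmf.expectation (seeds A j) (\<lambda>\<omega>. measure_pmf.expectation (A j) (\<lambda>a. V (Suc j) (f j a (trace f s \<omega> j))))"
    using fin by (simp add: expectation_seeds_Suc tr del: seeds.simps)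
  also have "\<dots> \<le> measure_pmf.expectation (seeds A j) (\<lambda>\<omega>. V j (trace f s \<omega> j) + e j)"
    using fin Suc.prems(2) inv_trace
    by (intro integral_mono_AE integrable_measure_pmf_finite) auto
  also have "\<dots> = measure_pmf.expectation (seeds A j) (\<lambda>\<omega>. V j (trace f s \<omega> j)) + e j"
    using fin by (simp add: integrable_measure_pmf_finite)
  also have "\<dots> \<le> V 0 s + (\<Sum>i<j. e i) + e j"
    using Suc.IH Suc.prems by simp
  finally show ?case by simp
qed simp

section \<open>Potentials\<close>

text \<open>When \<open>i\<close> agents have been served, \<open>N - i\<close> takes the role of the number of bundles left.\<close>

definition rate :: "nat \<Rightarrow> nat \<Rightarrow> real" where
  "rate N i = 4 / (17 * (real N - real i))"

lemma rate_bounds: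
  assumes "i < N"
  shows "0 < rate N i" "2 * rate N i < 1"
proof -
  have "1 \<le> real N - real i" using assms by linarith
  then show "0 < rate N i" "2 * rate N i < 1" by (auto simp: rate_def field_simps)
qed

context agent_view begin

text \<open>Besides the remaining goods \<open>R\<close> the state records the probability \<open>\<sigma>\<close> that a fixed good
  survives the sampling steps so far (at the doubled rate), and the number \<open>k\<close> of goods of \<open>U\<close> taken
  as singles, each weighted by \<open>1 / \<sigma>\<close> at that time. Thus \<open>\<sigma> * (card I - k)\<close> is a conservative
  count of the surviving bundles of small goods.\<close>

definition step :: "nat \<Rightarrow> (nat \<Rightarrow> real) \<Rightarrow> (nat \<Rightarrow> valuation) \<Rightarrow> nat \<Rightarrow> nat set list
    \<Rightarrow> nat set \<times> real \<times> real \<Rightarrow> nat set \<times> real \<times> real" where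
  "step N \<theta> w i a = (\<lambda>(R, \<sigma>, k). let D = pick m (rate N i) (\<theta> i) (w i) R a in
    (R - D,
     if (\<exists>g\<in>R. \<theta> i \<le> w i {g}) \<or> \<not> samplable m (rate N i) (\<theta> i) (w i) R then \<sigma> else \<sigma> * (1 - 2 * rate N i),
     if (\<exists>g\<in>R. \<theta> i \<le> w i {g}) \<and> D \<inter> U \<noteq> {} then k + 1 / \<sigma> else k))"

definition valid :: "nat set \<times> real \<times> real \<Rightarrow> bool" where
  "valid = (\<lambda>(R, \<sigma>, k). R \<subseteq> {1..m} \<and> 0 < \<sigma> \<and> \<sigma> \<le> 1 \<and> 0 \<le> k)"

lemma step_cases:
  assumes "i < N"
  obtains (large) g where "g \<in> R"
      "\<And>a. step N \<theta> w i a (R, \<sigma>, k) = (R - {g}, \<sigma>, if g \<in> U then k + 1 / \<sigma> else k)"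
  | (sample) "samplable m (rate N i) (\<theta> i) (w i) R"
      "\<And>a. step N \<theta> w i a (R, \<sigma>, k) = (R - first_good (\<theta> i) (w i) R a, \<sigma> * (1 - 2 * rate N i), k)"
  | (none) "\<And>a. step N \<theta> w i a (R, \<sigma>, k) = (R, \<sigma>, k)"
proof (cases "\<exists>g\<in>R. \<theta> i \<le> w i {g}")
  case True
  from pick_large[where m = m and q = "rate N i", OF this] obtain g where
    "g \<in> R" "\<And>a. pick m (rate N i) (\<theta> i) (w i) R a = {g}" by metis
  then show thesis using True by (intro large[of g]) (auto simp: step_def Let_def)
next
  case False
  show thesis
  proof (cases "samplable m (rate N i) (\<theta> i) (w i) R")
    case True
    then show thesis using False by (intro sample) (auto simp: step_def Let_def pick_def)
  next
    case nsam: False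
    show thesis using False nsam by (intro none) (auto simp: step_def Let_def pick_def)
  qed
qed

lemma valid_step:
  assumes "i < N" "valid s"
  shows "valid (step N \<theta> w i a s)"
proof -
  obtain R \<sigma> k where s: "s = (R, \<sigma>, k)" by (cases s)
  have "0 < 1 - 2 * rate N i" "1 - 2 * rate N i \<le> 1" using rate_bounds[OF assms(1)] by auto
  then have "0 < \<sigma> * (1 - 2 * rate N i)" "\<sigma> * (1 - 2 * rate N i) \<le> 1" if "0 < \<sigma>" "\<sigma> \<le> 1"
    using that by (auto intro!: mult_le_one)
  then show ?thesis using assms(2) unfolding s
    by (cases rule: step_cases[OF assms(1), of R \<theta> w \<sigma> k]) (auto simp: valid_def)
qed

text \<open>A single lowers the surviving count by at most 1, and so does sampling in the exponential
  mean as long as the count is close to \<open>N - i\<close>; when it is much larger, the potential is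
  negligible anyway, which accounts for the additive error in \<open>pot1_step\<close>.\<close>

definition pot1 :: "nat \<Rightarrow> nat \<Rightarrow> nat set \<times> real \<times> real \<Rightarrow> real" where
  "pot1 N i = (\<lambda>(R, \<sigma>, k).
    exp (- (4/3) * (real (card (Z \<inter> R)) + \<sigma> * max 0 (real (card I) - k) - (real N - real i))))"

lemma fin_Z: "finite Z" using Z_sub finite_subset by blast

text \<open>Passing from \<open>M\<close> to \<open>M - 1\<close> gains 4/3 in the exponent, while
  sampling costs at most \<open>c * (A + B)\<close>. Up to \<open>A + B = 101/100 * M\<close> the
  gain covers the cost. Beyond that, the old exponent outweighs the rest by
  \<open>4/3 * M / 100 = M / 75\<close>.\<close>

lemma pot1_numeric:
  fixes M A B r x :: real
  assumes M: "1 \<le> M" and A: "0 \<le> A" and B: "0 \<le> B" and r: "r = 8 / (17 * M)" and x: "x \<le> 3798/1000" "1 \<le> x"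
  shows "exp (- (4/3) * (A + B * (1 - r) - (M - 1)) + r * (x - 1) * A) \<le> exp (- (4/3) * (A + B - M)) + exp (- M / 75)"
proof -
  define c where "c = (13168/10000) / M"
  have rx: "r * (x - 1) \<le> c" "4/3 * r \<le> c" using M x by (auto simp: r c_def field_simps)
  define E where "E = - (4/3) * (A + B * (1 - r) - (M - 1)) + r * (x - 1) * A"
  have "r * (x - 1) * A \<le> c * A" "4/3 * r * B \<le> c * B"
    by (rule mult_right_mono[OF rx(1) A], rule mult_right_mono[OF rx(2) B])
  moreover have "E = - (4/3) * (A + B - M) - 4/3 + 4/3 * r * B + r * (x - 1) * A" by (simp add: E_def field_simps)
  ultimately have E: "E \<le> - (4/3) * (A + B - M) - 4/3 + c * (A + B)" by (simp only: distrib_left)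
  show ?thesis
  proof (cases "A + B \<le> 101/100 * M")
    case True
    have "c * (A + B) \<le> c * (101/100 * M)" using True M by (intro mult_left_mono) (auto simp: c_def)
    also have "\<dots> \<le> 4/3" using M by (simp add: c_def)
    finally have "E \<le> - (4/3) * (A + B - M)" using E by simp
    then have "exp E \<le> exp (- (4/3) * (A + B - M))" by simp
    then show ?thesis unfolding E_def by (smt (verit) exp_gt_zero)
  next
    case False
    have "c \<le> 4/3" using M by (simp add: c_def field_simps)
    then have "(4/3 - c) * (101/100 * M) \<le> (4/3 - c) * (A + B)" using False by (intro mult_left_mono) auto
    moreover have "c * (101/100 * M) \<le> 4/3" using M by (simp add: c_def)
    ultimately have "E \<le> - M / 75" using E unfolding left_diff_distrib by argo
    then have "exp E \<le> exp (- M / 75)" by simp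
    then show ?thesis unfolding E_def by (smt (verit) exp_gt_zero)
  qed
qed

lemma pot1_step:
  assumes i: "i < N" and s: "valid s"
  shows "measure_pmf.expectation (attempts m T (rate N i)) (\<lambda>a. pot1 N (Suc i) (step N \<theta> w i a s))
    \<le> pot1 N i s + exp (- (real N - real i) / 75)"
proof -
  obtain R \<sigma> k where s': "s = (R, \<sigma>, k)" by (cases s)
  have \<sigma>: "0 < \<sigma>" and R: "R \<subseteq> {1..m}" using s s' by (auto simp: valid_def)
  show ?thesis
  proof (cases rule: step_cases[OF i, of R \<theta> w \<sigma> k, case_names large sample none])
    case (large g)
    define k' where "k' = (if g \<in> U then k + 1 / \<sigma> else k)"
    have ZR: "Z \<inter> (R - {g}) = Z \<inter> R - {g}" by auto
    \<comment> \<open>One good is either at most one representative or raises \<open>k\<close> by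
      \<open>1 / \<sigma>\<close>, which weighs 1 after multiplication by \<open>\<sigma>\<close>;
      it cannot be both, as \<open>Z\<close> and \<open>U\<close> are disjoint.\<close>
    have "real (card (Z \<inter> R)) + \<sigma> * max 0 (real (card I) - k) - 1
        \<le> real (card (Z \<inter> (R - {g}))) + \<sigma> * max 0 (real (card I) - k')"
    proof (cases "g \<in> U")
      case True
      then have "g \<notin> Z" using Z_U by auto
      moreover have "max 0 (y - k) - t \<le> max 0 (y - (k + t))" if "0 \<le> t" for y t :: real
        using that by (simp add: max_def)
      then have "max 0 (real (card I) - k) - 1 / \<sigma> \<le> max 0 (real (card I) - k')"
        using True \<sigma> by (simp add: k'_def)
      then have "\<sigma> * (max 0 (real (card I) - k) - 1 / \<sigma>) \<le> \<sigma> * max 0 (real (card I) - k')"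
        using \<sigma> by (intro mult_left_mono) auto
      ultimately show ?thesis using \<sigma> unfolding ZR by (simp add: right_diff_distrib)
    next
      case False
      have "card (Z \<inter> R) \<le> card (Z \<inter> R - {g}) + 1"
        using fin_Z by (auto simp: card_Diff_singleton_if)
      then show ?thesis using False unfolding ZR by (simp add: k'_def)
    qed
    then have "pot1 N (Suc i) (R - {g}, \<sigma>, k') \<le> pot1 N i (R, \<sigma>, k)"
      by (simp add: pot1_def)
    then show ?thesis using large by (simp add: s' k'_def add_increasing2)
  next
    case sample
    define M where "M = real N - real i"
    define A where "A = real (card (Z \<inter> R))"
    define B where "B = \<sigma> * max 0 (real (card I) - k)"
    define r where "r = 2 * rate N i"
    define x where "x = exp (4/3 :: real)"
    have M1: "1 \<le> M" using i by (simp add: M_def)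
    have r: "r = 8 / (17 * M)" by (simp add: r_def rate_def M_def)
    have r01: "0 \<le> r" "r \<le> 1" using rate_bounds[OF i] by (auto simp: r_def)
    \<comment> \<open>Only the number of lost representatives is random. Its exponential moment is
      dominated by that of a binomial variable at the doubled rate \<open>r\<close>.\<close>
    define C where "C = exp (- (4/3) * (A + B * (1 - r) - (M - 1)))"
    have pot: "pot1 N (Suc i) (R - D, \<sigma> * (1 - r), k) = C * x ^ card ((Z \<inter> R) \<inter> D)" for D
    proof -
      have "card ((Z \<inter> R) \<inter> D) + card (Z \<inter> (R - D)) = card (Z \<inter> R)"
        using fin_Z by (subst card_Un_disjoint[symmetric]) (auto intro!: arg_cong[where f = card])
      then have cR: "real (card (Z \<inter> (R - D))) = A - real (card ((Z \<inter> R) \<inter> D))" by (simp add: A_def)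
      have BR: "\<sigma> * (1 - r) * max 0 (real (card I) - k) = B * (1 - r)" by (simp add: B_def)
      have "pot1 N (Suc i) (R - D, \<sigma> * (1 - r), k)
          = exp (- (4/3) * (A - real (card ((Z \<inter> R) \<inter> D)) + B * (1 - r) - (M - 1)))"
        unfolding pot1_def prod.case cR BR M_def by (simp add: algebra_simps)
      also have "\<dots> = exp (- (4/3) * (A + B * (1 - r) - (M - 1)) + real (card ((Z \<inter> R) \<inter> D)) * (4/3))"
        by (simp add: field_simps)
      also have "\<dots> = C * x ^ card ((Z \<inter> R) \<inter> D)"
        by (simp only: C_def x_def exp_add exp_of_nat_mult)
      finally show ?thesis .
    qed
    have sm: "increasing (\<lambda>D. x ^ card ((Z \<inter> R) \<inter> D)) \<and> supermodular (\<lambda>D. x ^ card ((Z \<inter> R) \<inter> D))"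
      by (rule supermodular_power_card) (use fin_Z in \<open>auto simp: x_def\<close>)
    have "measure_pmf.expectation (attempts m T (rate N i)) (\<lambda>a. pot1 N (Suc i) (step N \<theta> w i a (R, \<sigma>, k)))
        = C * measure_pmf.expectation (attempts m T (rate N i)) (\<lambda>a. x ^ card ((Z \<inter> R) \<inter> first_good (\<theta> i) (w i) R a))"
      unfolding sample(2) r_def[symmetric] pot by simp
    also have "\<dots> \<le> C * E_sub m r (\<lambda>D. x ^ card ((Z \<inter> R) \<inter> D))"
      unfolding r_def using sm rate_bounds[OF i] sample(1)
      by (intro mult_left_mono first_good_dominated) (auto simp: C_def)
    also have "E_sub m r (\<lambda>D. x ^ card ((Z \<inter> R) \<inter> D)) = (1 + r * (x - 1)) ^ card (Z \<inter> R)"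
    proof -
      have "Z \<inter> R \<inter> {1..m} = Z \<inter> R" using R by auto
      then show ?thesis using E_sub_power_card[OF r01, of m x "Z \<inter> R"] by (simp add: algebra_simps)
    qed
    also have "C * (1 + r * (x - 1)) ^ card (Z \<inter> R) \<le> C * exp (r * (x - 1) * A)"
    proof -
      have "0 \<le> r * (x - 1)" using r01 by (simp add: x_def)
      then have "(1 + r * (x - 1)) ^ card (Z \<inter> R) \<le> exp (r * (x - 1)) ^ card (Z \<inter> R)"
        by (intro power_mono exp_ge_add_one_self) auto
      also have "\<dots> = exp (r * (x - 1) * A)" by (simp add: A_def exp_of_nat_mult[symmetric] mult.commute)
      finally show ?thesis by (simp add: C_def)
    qed
    also have "\<dots> = exp (- (4/3) * (A + B * (1 - r) - (M - 1)) + r * (x - 1) * A)"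
      by (simp only: C_def exp_add)
    also have "\<dots> \<le> exp (- (4/3) * (A + B - M)) + exp (- M / 75)"
      by (rule pot1_numeric) (use M1 r \<sigma> exp_numeric_bounds(3) in \<open>auto simp: A_def B_def x_def\<close>)
    also have "\<dots> = pot1 N i (R, \<sigma>, k) + exp (- (real N - real i) / 75)"
      by (simp add: pot1_def A_def B_def M_def)
    finally show ?thesis by (simp add: s')
  next
    case none
    have "pot1 N (Suc i) (R, \<sigma>, k) \<le> pot1 N i (R, \<sigma>, k)" by (simp add: pot1_def)
    then show ?thesis using none by (simp add: s' add_increasing2)
  qed
qed

text \<open>Raising the colouring rate to \<open>\<rho> / \<sigma>\<close> compensates exactly for the thinning of \<open>R\<close>. Above
  rate \<open>1 / K\<close> a colouring with \<open>K\<close> colours makes no sense, and the potential is abandoned.\<close>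

definition pot2 :: "nat \<Rightarrow> real \<Rightarrow> nat set \<times> real \<times> real \<Rightarrow> real" where
  "pot2 K \<rho> = (\<lambda>(R, \<sigma>, k).
    if real K * \<rho> \<le> \<sigma> then col_pot K (\<rho> / \<sigma>) R * exp (- (3/4) * real K * \<rho> * k) else 0)"

lemma pot2_nonneg: "0 \<le> \<rho> \<Longrightarrow> valid s \<Longrightarrow> 0 \<le> pot2 K \<rho> s"
  by (auto simp: pot2_def valid_def split: prod.splits intro!: mult_nonneg_nonneg col_pot_nonneg)

text \<open>For a single good of \<open>U\<close>, the increase of \<open>k\<close> by
  \<open>1 / \<sigma>\<close> cancels the factor from \<open>col_pot_remove\<close>. For sampling,
  \<open>first_good_dominated\<close> reduces the loss to independent thinning, which turns the rate
  \<open>\<rho> / (\<sigma> * (1 - r))\<close> back into \<open>\<rho> / \<sigma>\<close>.\<close>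

lemma pot2_step:
  assumes i: "i < N" and s: "valid s" and \<rho>: "0 \<le> \<rho>"
  shows "measure_pmf.expectation (attempts m T (rate N i)) (\<lambda>a. pot2 K \<rho> (step N \<theta> w i a s)) \<le> pot2 K \<rho> s"
proof -
  obtain R \<sigma> k where s': "s = (R, \<sigma>, k)" by (cases s)
  have \<sigma>: "0 < \<sigma>" and R: "R \<subseteq> {1..m}" using s s' by (auto simp: valid_def)
  show ?thesis
  proof (cases rule: step_cases[OF i, of R \<theta> w \<sigma> k, case_names large sample none])
    case (large g)
    have "pot2 K \<rho> (R - {g}, \<sigma>, if g \<in> U then k + 1 / \<sigma> else k) \<le> pot2 K \<rho> (R, \<sigma>, k)"
    proof (cases "real K * \<rho> \<le> \<sigma>")
      case True
      then have K: "0 \<le> \<rho> / \<sigma>" "real K * (\<rho> / \<sigma>) \<le> 1" using \<sigma> \<rho> by auto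
      show ?thesis
      proof (cases "g \<in> U")
        case gU: True
        have "col_pot K (\<rho> / \<sigma>) (R - {g}) * exp (- (3/4) * real K * \<rho> * (k + 1 / \<sigma>))
            \<le> (exp (3/4 * real K * (\<rho> / \<sigma>)) * col_pot K (\<rho> / \<sigma>) R) * exp (- (3/4) * real K * \<rho> * (k + 1 / \<sigma>))"
          by (intro mult_right_mono col_pot_remove K gU large(1)) simp
        also have "\<dots> = col_pot K (\<rho> / \<sigma>) R * (exp (3/4 * real K * (\<rho> / \<sigma>)) * exp (- (3/4) * real K * \<rho> * (k + 1 / \<sigma>)))"
          by simp
        also have "\<dots> = col_pot K (\<rho> / \<sigma>) R * exp (- (3/4) * real K * \<rho> * k)"
          by (simp add: exp_add[symmetric] algebra_simps)
        finally show ?thesis using True gU by (simp add: pot2_def)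
      next
        case False
        then have "X \<inter> U \<inter> (R - {g}) = X \<inter> U \<inter> R" for X by auto
        then have "col_pot K (\<rho> / \<sigma>) (R - {g}) = col_pot K (\<rho> / \<sigma>) R"
          unfolding col_pot_def col_val_def by simp
        then show ?thesis using False by (simp add: pot2_def)
      qed
    qed (simp add: pot2_def)
    then show ?thesis using large by (simp add: s')
  next
    case sample
    define r where "r = 2 * rate N i"
    have r01: "0 \<le> r" "r < 1" using rate_bounds[OF i] by (auto simp: r_def)
    show ?thesis
    proof (cases "real K * \<rho> \<le> \<sigma> * (1 - r)")
      case True
      define \<rho>' where "\<rho>' = \<rho> / (\<sigma> * (1 - r))"
      have K: "0 \<le> \<rho>'" "real K * \<rho>' \<le> 1" using True \<rho> \<sigma> r01 by (auto simp: \<rho>'_def)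
      have "\<sigma> * (1 - r) \<le> \<sigma>" using \<sigma> r01 by (simp add: mult_le_cancel_left1)
      then have K': "real K * \<rho> \<le> \<sigma>" using True by simp
      have "measure_pmf.expectation (attempts m T (rate N i)) (\<lambda>a. pot2 K \<rho> (step N \<theta> w i a (R, \<sigma>, k)))
          = measure_pmf.expectation (attempts m T (rate N i)) (\<lambda>a. col_pot K \<rho>' (R - first_good (\<theta> i) (w i) R a)) * exp (- (3/4) * real K * \<rho> * k)"
        unfolding sample(2) r_def[symmetric] using True by (simp add: pot2_def \<rho>'_def)
      also have "\<dots> \<le> E_sub m r (\<lambda>D. col_pot K \<rho>' (R - D)) * exp (- (3/4) * real K * \<rho> * k)"
        unfolding r_def using col_pot_supermodular[OF K, of R] rate_bounds[OF i] sample(1)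
        by (intro mult_right_mono first_good_dominated) auto
      also have "E_sub m r (\<lambda>D. col_pot K \<rho>' (R - D)) = col_pot K (\<rho> / \<sigma>) R"
        using r01 by (simp add: col_pot_thin \<rho>'_def)
      finally show ?thesis using K' by (simp add: s' pot2_def)
    next
      case False
      \<comment> \<open>Dropping to 0 is harmless, because the potential was nonnegative
        before.\<close>
      have "pot2 K \<rho> (R', \<sigma> * (1 - r), k) = 0" for R' using False by (simp add: pot2_def)
      then show ?thesis
        unfolding s' sample(2) r_def[symmetric] using pot2_nonneg[OF \<rho>, of "(R, \<sigma>, k)" K] s s' by simp
    qed
  next
    case none
    then show ?thesis by (simp add: s')
  qed
qed

end

section \<open>The probability that an agent gets stuck\<close>

lemma sum_exp_le:
  fixes t c :: real
  assumes "finite X" "0 < t" "\<And>k. k \<in> X \<Longrightarrow> c \<le> real k"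
  shows "(\<Sum>k\<in>X. exp (- t * real k)) \<le> exp (- t * c) * ((1 + t) / t)"
proof -
  define k0 where "k0 = nat \<lceil>c\<rceil>"
  define z where "z = exp (- t)"
  obtain n where n: "\<And>k. k \<in> X \<Longrightarrow> k < n"
    using assms(1) by (meson finite_nat_set_iff_bounded)
  have z: "0 < z" "z < 1" "1 / (1 - z) \<le> (1 + t) / t"
  proof -
    have "1 + t \<le> exp t" by simp
    then have "z \<le> 1 / (1 + t)" using assms(2) by (simp add: z_def exp_minus field_simps)
    moreover have "z < 1" using assms(2) by (simp add: z_def)
    ultimately show "1 / (1 - z) \<le> (1 + t) / t" using assms(2) by (simp add: field_simps)
  qed (use assms(2) in \<open>auto simp: z_def\<close>)
  have zk: "exp (- t * real k) = z ^ k" for k by (simp add: z_def exp_of_nat_mult[symmetric] mult.commute)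
  have "(\<Sum>k\<in>X. z ^ k) \<le> (\<Sum>k\<in>{k0..<k0 + n}. z ^ k)"
  proof (rule sum_mono2)
    show "X \<subseteq> {k0..<k0 + n}"
    proof
      fix k assume k: "k \<in> X"
      show "k \<in> {k0..<k0 + n}" using assms(3)[OF k] n[OF k] by (auto simp: k0_def)
    qed
  qed (use z in auto)
  also have "\<dots> = z ^ k0 * (\<Sum>i<n. z ^ i)"
    by (subst sum.shift_bounds_nat_ivl[of _ 0 k0 n, simplified add_0 add.commute[of n]])
      (simp add: sum_distrib_left power_add lessThan_atLeast0 mult.commute)
  also have "\<dots> \<le> z ^ k0 * (1 / (1 - z))"
    using z by (intro mult_left_mono) (auto simp: sum_gp_strict field_simps)
  also have "\<dots> \<le> exp (- t * c) * ((1 + t) / t)"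
  proof (intro mult_mono)
    have "c \<le> real k0" unfolding k0_def by linarith
    then show "z ^ k0 \<le> exp (- t * c)" unfolding zk[symmetric] using assms(2) by simp
  qed (use z assms(2) in auto)
  finally show ?thesis unfolding zk .
qed

context agent_view begin

definition stuck :: "nat \<Rightarrow> nat \<Rightarrow> nat set \<Rightarrow> bool" where
  "stuck N j R \<longleftrightarrow> \<not> (\<exists>g\<in>R. 1 \<le> u {g}) \<and> \<not> samplable m (rate N j) 1 u R"

text \<open>A surviving representative would be a single good of unit value, so none is left. The
  exponent 1/2 is 4/3 * (1 - 5/8).\<close>

lemma pot1_stuck:
  assumes "stuck N j R" "\<sigma> * max 0 (real (card I) - k) \<le> 5/8 * (real N - real j)"
  shows "exp ((real N - real j) / 2) \<le> pot1 N j (R, \<sigma>, k)"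
proof -
  have "Z \<inter> R = {}" using assms(1) large by (auto simp: stuck_def)
  moreover have "(real N - real j) / 2 \<le> - (4/3) * (\<sigma> * max 0 (real (card I) - k) - (real N - real j))"
    using assms(2) by argo
  ultimately show ?thesis by (simp add: pot1_def)
qed

text \<open>With \<open>K\<close> about \<open>\<sigma> / \<rho>\<close> colours the classes use up nearly all goods, and each of them
  is at most as large as a sample at the agent's rate, so at least half of them are worthless
  on average.\<close>

lemma pot2_stuck:
  assumes st: "stuck N j R" and j: "j < N" and v: "valid (R, \<sigma>, k)"
    and B: "5/8 * (real N - real j) < \<sigma> * max 0 (real (card I) - k)"
  defines "\<rho> \<equiv> 5 / (34 * real (card I))"
  obtains K where "real K * \<rho> \<le> 1" "17/4 * (real N - real j) - 1 \<le> real K"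
    "exp (9/34 * real K + 15/32 * (real N - real j) - 15/136) \<le> pot2 K \<rho> (R, \<sigma>, k)"
proof
  define M where "M = real N - real j"
  define b where "b = real (card I)"
  have M: "1 \<le> M" using j by (simp add: M_def)
  have \<sigma>: "0 < \<sigma>" "\<sigma> \<le> 1" and k: "0 \<le> k" and R: "R \<subseteq> {1..m}" using v by (auto simp: valid_def)
  have "0 < \<sigma> * max 0 (b - k)" using B M unfolding M_def[symmetric] b_def[symmetric] by linarith
  then have bk: "0 < b - k" using \<sigma> by (auto simp: zero_less_mult_iff)
  then have b: "0 < b" using k by simp
  have B': "5/8 * M < \<sigma> * (b - k)" using B bk by (simp add: M_def b_def)
  have "\<sigma> * (b - k) \<le> \<sigma> * b" using \<sigma> k by (intro mult_left_mono) auto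
  then have \<sigma>b: "5/8 * M < \<sigma> * b" using B' by simp
  have \<rho>: "\<rho> = 5 / (34 * b)" "0 < \<rho>" using b by (auto simp: \<rho>_def b_def)
  \<comment> \<open>Since \<open>\<sigma> * b > 5/8 * M\<close>, the choice of \<open>\<rho>\<close>
    makes \<open>x = 34/5 * \<sigma> * b\<close> exceed \<open>17/4 * M\<close>. Hence the colouring
    rate \<open>1 / x\<close> is at most the agent's sampling rate.\<close>
  define x where "x = \<sigma> / \<rho>"
  have x: "17/4 * M < x" using \<sigma>b b by (simp add: x_def \<rho> field_simps)
  define K where "K = nat \<lfloor>x\<rfloor>"
  have K: "real K \<le> x" "x - 1 < real K" using x M by (auto simp: K_def of_nat_nat)
  have K\<rho>: "real K * \<rho> \<le> \<sigma>" using K(1) \<rho>(2) by (simp add: x_def field_simps)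
  then show "real K * \<rho> \<le> 1" using \<sigma> by simp
  show "17/4 * (real N - real j) - 1 \<le> real K" using x K(2) unfolding M_def by argo
  define \<rho>' where "\<rho>' = \<rho> / \<sigma>"
  have "\<rho>' = 1 / x" by (simp add: \<rho>'_def x_def)
  also have "\<dots> \<le> 1 / (17/4 * M)" using x M by (intro divide_left_mono) auto
  finally have \<rho>': "\<rho>' \<le> 4 / (17 * M)" "0 \<le> \<rho>'" using \<rho> \<sigma> by (auto simp: \<rho>'_def)
  have rate: "rate N j = 4 / (17 * M)" by (simp add: rate_def M_def)
  have rate1: "rate N j \<le> 1" "\<rho>' \<le> rate N j" using rate_bounds[OF j] \<rho>' rate by auto
  \<comment> \<open>A sample fails to reach 1 with probability at least 1/2, and then it falls short
    of 2 by more than 1.\<close>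
  have "1/2 \<le> E_sub m (rate N j) (\<lambda>D. 1 - indicator {S. 1 \<le> u (S \<inter> R)} D)"
    using st by (simp add: stuck_def samplable_def)
  also have "\<dots> \<le> E_sub m (rate N j) (\<lambda>D. max 0 (2 - u (D \<inter> U \<inter> R)))"
  proof (rule E_sub_mono)
    fix D
    have "u (D \<inter> U \<inter> R) \<le> u (D \<inter> R)" using R by (intro u_mono) auto
    then show "1 - indicator {S. 1 \<le> u (S \<inter> R)} D \<le> max 0 (2 - u (D \<inter> U \<inter> R))"
      by (auto simp: indicator_def)
  qed
  also have "\<dots> \<le> E_sub m \<rho>' (\<lambda>D. max 0 (2 - u (D \<inter> U \<inter> R)))"
  proof (rule E_sub_antimono_rate[OF _ \<rho>'(2) rate1(2,1)])
    fix A B :: "nat set" assume "A \<subseteq> B"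
    then have "u (A \<inter> U \<inter> R) \<le> u (B \<inter> U \<inter> R)" using R by (intro u_mono) auto
    then show "max 0 (2 - u (B \<inter> U \<inter> R)) \<le> max 0 (2 - u (A \<inter> U \<inter> R))" by auto
  qed
  finally have half: "1/2 \<le> E_sub m \<rho>' (\<lambda>D. max 0 (2 - u (D \<inter> U \<inter> R)))" .
  have K\<rho>': "real K * \<rho>' \<le> 1" using K\<rho> \<sigma> by (simp add: \<rho>'_def field_simps)
  have "exp (3/4 * real K * (1/2)) \<le> exp (3/4 * real K * E_sub m \<rho>' (\<lambda>D. max 0 (2 - u (D \<inter> U \<inter> R))))"
    unfolding exp_le_cancel_iff by (rule mult_left_mono[OF half]) simp
  also have "\<dots> \<le> col_pot K \<rho>' R"
    by (rule col_pot_lower) (use \<rho>' K\<rho>' rate1 in auto)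
  finally have "exp (3/4 * real K * (1/2)) * exp (- (3/4) * real K * \<rho> * k)
      \<le> col_pot K \<rho>' R * exp (- (3/4) * real K * \<rho> * k)"
    by (rule mult_right_mono) simp
  also have "\<dots> = pot2 K \<rho> (R, \<sigma>, k)" using K\<rho> by (simp add: pot2_def \<rho>'_def)
  finally have low: "exp (3/8 * real K - 3/4 * (real K * \<rho> * k)) \<le> pot2 K \<rho> (R, \<sigma>, k)"
    by (simp add: exp_add[symmetric] algebra_simps)
  \<comment> \<open>Rounding \<open>x\<close> down to \<open>K\<close> costs at most
    \<open>5/8 * M / x \<le> 5/34\<close>.\<close>
  have "real K * \<rho> * k \<le> 5/34 * real K - 5/8 * M + 5/34"
  proof -
    have "k \<le> b - 5/8 * M / \<sigma>" using B' \<sigma> by (simp add: field_simps)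
    then have "real K * \<rho> * k \<le> real K * \<rho> * (b - 5/8 * M / \<sigma>)" using \<rho> by (intro mult_left_mono) auto
    also have "\<dots> = 5/34 * real K - 5/8 * M * (real K / x)"
      using b \<sigma> by (simp add: \<rho> x_def field_simps)
    finally have 1: "real K * \<rho> * k \<le> 5/34 * real K - 5/8 * M * (real K / x)" .
    have "5/8 * M - 5/34 \<le> 5/8 * M * (1 - 1 / x)"
    proof -
      have "M / x \<le> 4/17" using x M by (simp add: field_simps)
      moreover have "5/8 * M * (1 - 1 / x) = 5/8 * M - 5/8 * (M / x)" by (simp add: right_diff_distrib)
      ultimately show ?thesis by argo
    qed
    also have "\<dots> \<le> 5/8 * M * (real K / x)"
    proof (rule mult_left_mono)
      have "0 < x" using x M by linarith
      then have "1 - 1 / x = (x - 1) / x" by (simp add: field_simps)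
      also have "\<dots> \<le> real K / x" using K(2) \<open>0 < x\<close> by (intro divide_right_mono) auto
      finally show "1 - 1 / x \<le> real K / x" .
    qed (use M in simp)
    finally show ?thesis using 1 by simp
  qed
  \<comment> \<open>The coefficient of \<open>K\<close> is 3/8 - 3/4 * 5/34 = 9/34.\<close>
  then have "9/34 * real K + 15/32 * M - 15/136 \<le> 3/8 * real K - 3/4 * (real K * \<rho> * k)" by argo
  then have "exp (9/34 * real K + 15/32 * M - 15/136) \<le> exp (3/8 * real K - 3/4 * (real K * \<rho> * k))"
    unfolding exp_le_cancel_iff .
  also note low
  finally show "exp (9/34 * real K + 15/32 * (real N - real j) - 15/136) \<le> pot2 K \<rho> (R, \<sigma>, k)"
    unfolding M_def .
qed

text \<open>Negative association reduces the potential to the \<open>K\<close>-th power of the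
  moment of one class, which \<open>E_psi_le\<close> and \<open>poisson_value\<close> bound.\<close>

lemma pot2_start:
  assumes "0 < card I" "real K * (5 / (34 * real (card I))) \<le> 1"
  shows "pot2 K (5 / (34 * real (card I))) ({1..m}, 1, 0) \<le> exp (35/136 * real K)"
proof -
  define \<rho> where "\<rho> = 5 / (34 * real (card I))"
  have "1 \<le> real (card I)" using assms(1) by linarith
  then have \<rho>: "0 \<le> \<rho>" "\<rho> \<le> 1" "22 * real (card I) * \<rho> = 55/17" by (auto simp: \<rho>_def field_simps)
  have "col_pot K \<rho> {1..m} \<le> E_sub m \<rho> (\<lambda>D. psi 2 (u (D \<inter> U \<inter> {1..m}))) ^ K"
    by (rule col_pot_start) (use assms \<rho> in \<open>auto simp: \<rho>_def\<close>)
  also have "\<dots> = E_sub m \<rho> (\<lambda>D. psi 2 (u (D \<inter> U))) ^ K"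
  proof -
    have "D \<inter> U \<inter> {1..m} = D \<inter> U" for D using U_sub by auto
    then show ?thesis by simp
  qed
  also have "\<dots> \<le> exp (35/136) ^ K"
    using E_psi_le[OF \<rho>(1,2)] poisson_value unfolding \<rho>(3)
    by (intro power_mono integral_nonneg_AE) auto
  also have "\<dots> = exp (35/136 * real K)" by (simp add: exp_of_nat_mult[symmetric] mult.commute)
  finally show ?thesis using assms by (simp add: pot2_def \<rho>_def)
qed

text \<open>Markov's inequality: a stuck agent makes \<open>pot1\<close> large or, for some number
  \<open>K\<close> of colours, \<open>pot2\<close>. That number depends on the random
  \<open>\<sigma>\<close>, so the bound is summed over all \<open>K\<close> in a fixed finite
  set.\<close>

lemma stuck_prob:
  fixes T :: nat and \<theta> :: "nat \<Rightarrow> real" and w :: "nat \<Rightarrow> valuation"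
  assumes j: "j < N" and N: "card Z + card I = N"
  defines "A \<equiv> \<lambda>i. attempts m T (rate N i)"
  defines "s \<equiv> \<lambda>\<omega>. trace (step N \<theta> w) ({1..m}, 1, 0) \<omega> j"
  shows "measure_pmf.expectation (seeds A j) (\<lambda>\<omega>. of_bool (stuck N j (fst (s \<omega>))))
    \<le> 351 * exp (- (real N - real j) / 2)"
proof -
  define M where "M = real N - real j"
  define \<rho> where "\<rho> = 5 / (34 * real (card I))"
  define X where "X = {K. real K * \<rho> \<le> 1 \<and> 17/4 * M - 1 \<le> real K \<and> 0 < card I}"
  have M: "1 \<le> M" using j by (simp add: M_def)
  have fin: "finite (set_pmf (A i))" for i by (simp add: A_def)
  have int: "integrable (measure_pmf (seeds A j)) f" for f :: "_ \<Rightarrow> real"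
    by (rule integrable_measure_pmf_finite) (simp add: fin)
  have \<rho>: "0 \<le> \<rho>" by (simp add: \<rho>_def)
  have valid0: "valid ({1..m}, 1, 0)" by (simp add: valid_def)
  have valid_s: "valid (trace (step N \<theta> w) ({1..m}, 1, 0) \<omega> i)" if "i \<le> j" for i \<omega>
    using that
  proof (induction i)
    case (Suc i)
    then show ?case using j by (simp add: valid_step)
  qed (use valid0 in simp)
  have finX: "finite X"
  proof (cases "card I = 0")
    case False
    have "X \<subseteq> {..nat \<lceil>1 / \<rho>\<rceil>}"
    proof
      fix K assume "K \<in> X"
      then have "real K \<le> 1 / \<rho>" using False by (simp add: X_def \<rho>_def field_simps)
      then show "K \<in> {..nat \<lceil>1 / \<rho>\<rceil>}" by (simp add: nat_le_iff le_nat_iff) linarith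
    qed
    then show ?thesis using finite_subset by blast
  qed (simp add: X_def)
  have E1: "measure_pmf.expectation (seeds A j) (\<lambda>\<omega>. pot1 N j (s \<omega>)) \<le> 77"
  proof -
    have "measure_pmf.expectation (seeds A j) (\<lambda>\<omega>. pot1 N j (s \<omega>))
        \<le> pot1 N 0 ({1..m}, 1, 0) + (\<Sum>i<j. exp (- (real N - real i) / 75))"
      unfolding s_def
    proof (rule expectation_trace_le[where Inv = valid, OF fin valid0])
      fix i s assume "i < j" "valid s"
      then show "measure_pmf.expectation (A i) (\<lambda>a. pot1 N (Suc i) (step N \<theta> w i a s))
          \<le> pot1 N i s + exp (- (real N - real i) / 75)"
        using j pot1_step[of i N s] by (simp add: A_def)
    qed (use j in \<open>auto intro: valid_step\<close>)
    also have "pot1 N 0 ({1..m}, 1, 0) = 1"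
    proof -
      have "Z \<inter> {1..m} = Z" using Z_sub by auto
      then show ?thesis using N by (simp add: pot1_def of_nat_add[symmetric] del: of_nat_add)
    qed
    \<comment> \<open>The errors form a geometric sum of at most 76, whatever \<open>N\<close> is;
      with the initial value 1 this gives 77.\<close>
    also have "(\<Sum>i<j. exp (- (real N - real i) / 75)) = (\<Sum>k\<in>(\<lambda>i. N - i) ` {..<j}. exp (- (1/75) * real k))"
    proof (subst sum.reindex)
      show "inj_on (\<lambda>i. N - i) {..<j}" using j by (auto simp: inj_on_def)
      show "(\<Sum>i<j. exp (- (real N - real i) / 75)) = sum ((\<lambda>k. exp (- (1/75) * real k)) \<circ> (\<lambda>i. N - i)) {..<j}"
        using j by (intro sum.cong) (simp_all add: of_nat_diff diff_divide_distrib)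
    qed
    also have "\<dots> \<le> exp (- (1/75) * 0) * ((1 + 1/75) / (1/75))"
      by (rule sum_exp_le) auto
    finally show ?thesis by simp
  qed
  have E2: "measure_pmf.expectation (seeds A j) (\<lambda>\<omega>. pot2 K \<rho> (s \<omega>)) \<le> exp (35/136 * real K)" if "K \<in> X" for K
  proof -
    have "measure_pmf.expectation (seeds A j) (\<lambda>\<omega>. pot2 K \<rho> (s \<omega>))
        \<le> pot2 K \<rho> ({1..m}, 1, 0) + (\<Sum>i<j. 0)"
      unfolding s_def
    proof (rule expectation_trace_le[where Inv = valid and V = "\<lambda>_. pot2 K \<rho>", OF fin valid0])
      fix i s assume "i < j" "valid s"
      then show "measure_pmf.expectation (A i) (\<lambda>a. pot2 K \<rho> (step N \<theta> w i a s)) \<le> pot2 K \<rho> s + 0"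
        using j pot2_step[of i N s \<rho>] \<rho> by (simp add: A_def)
    qed (use j in \<open>auto intro: valid_step\<close>)
    also have "\<dots> \<le> exp (35/136 * real K)"
    proof -
      have "0 < card I" "real K * (5 / (34 * real (card I))) \<le> 1" using that by (auto simp: X_def \<rho>_def)
      from pot2_start[OF this] show ?thesis by (simp add: \<rho>_def)
    qed
    finally show ?thesis .
  qed
  \<comment> \<open>The reciprocal of the level that \<open>pot2_stuck\<close> guarantees.\<close>
  define e where "e = (\<lambda>K. exp (- (9/34 * real K + 15/32 * M - 15/136)))"
  have "measure_pmf.expectation (seeds A j) (\<lambda>\<omega>. of_bool (stuck N j (fst (s \<omega>))))
      \<le> measure_pmf.expectation (seeds A j) (\<lambda>\<omega>. exp (- M / 2) * pot1 N j (s \<omega>) + (\<Sum>K\<in>X. e K * pot2 K \<rho> (s \<omega>)))"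
  proof (rule integral_mono_AE[OF int int], rule AE_I2)
    fix \<omega>
    obtain R \<sigma> k where s: "s \<omega> = (R, \<sigma>, k)" by (cases "s \<omega>")
    have v: "valid (R, \<sigma>, k)" using valid_s[of j \<omega>] s by (simp add: s_def)
    have nn1: "0 \<le> exp (- M / 2) * pot1 N j (R, \<sigma>, k)" by (simp add: pot1_def)
    have nn2: "0 \<le> e K * pot2 K \<rho> (R, \<sigma>, k)" for K
      using pot2_nonneg[OF \<rho> v] by (simp add: e_def)
    have nn3: "0 \<le> (\<Sum>K\<in>X. e K * pot2 K \<rho> (R, \<sigma>, k))" by (intro sum_nonneg nn2)
    have "1 \<le> exp (- M / 2) * pot1 N j (R, \<sigma>, k) + (\<Sum>K\<in>X. e K * pot2 K \<rho> (R, \<sigma>, k))" if st: "stuck N j R"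
    proof (cases "\<sigma> * max 0 (real (card I) - k) \<le> 5/8 * M")
      case True
      have "exp (- M / 2) * exp (M / 2) \<le> exp (- M / 2) * pot1 N j (R, \<sigma>, k)"
        using pot1_stuck[OF st] True by (intro mult_left_mono) (auto simp: M_def)
      then show ?thesis using nn3 by (simp add: exp_add[symmetric])
    next
      case False
      then have B: "5/8 * (real N - real j) < \<sigma> * max 0 (real (card I) - k)" by (simp add: M_def)
      obtain K where K: "real K * \<rho> \<le> 1" "17/4 * M - 1 \<le> real K"
        "exp (9/34 * real K + 15/32 * M - 15/136) \<le> pot2 K \<rho> (R, \<sigma>, k)"
        using pot2_stuck[OF st j v B] unfolding \<rho>_def M_def by blast
      have "0 < card I"
      proof (rule ccontr)
        assume "\<not> 0 < card I"
        then have "max 0 (real (card I) - k) = 0" using v by (simp add: valid_def)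
        then show False using False M by simp
      qed
      then have "K \<in> X" using K by (simp add: X_def)
      have "1 = e K * exp (9/34 * real K + 15/32 * M - 15/136)"
        unfolding e_def by (simp add: exp_add[symmetric] del: exp_minus)
      also have "\<dots> \<le> e K * pot2 K \<rho> (R, \<sigma>, k)"
        using K(3) by (intro mult_left_mono) (auto simp: e_def)
      also have "\<dots> \<le> (\<Sum>K\<in>X. e K * pot2 K \<rho> (R, \<sigma>, k))"
        by (rule member_le_sum[OF \<open>K \<in> X\<close> _ finX]) (rule nn2)
      finally show ?thesis using nn1 by simp
    qed
    then show "of_bool (stuck N j (fst (s \<omega>))) \<le> exp (- M / 2) * pot1 N j (s \<omega>) + (\<Sum>K\<in>X. e K * pot2 K \<rho> (s \<omega>))"
      using nn1 nn3 unfolding s by (cases "stuck N j R") auto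
  qed
  also have "\<dots> = exp (- M / 2) * measure_pmf.expectation (seeds A j) (\<lambda>\<omega>. pot1 N j (s \<omega>))
      + (\<Sum>K\<in>X. e K * measure_pmf.expectation (seeds A j) (\<lambda>\<omega>. pot2 K \<rho> (s \<omega>)))"
    by (simp add: int)
  also have "\<dots> \<le> exp (- M / 2) * 77 + (\<Sum>K\<in>X. e K * exp (35/136 * real K))"
    by (intro add_mono mult_left_mono sum_mono E1 E2) (auto simp: e_def)
  also have "(\<Sum>K\<in>X. e K * exp (35/136 * real K)) = exp (15/136 - 15/32 * M) * (\<Sum>K\<in>X. exp (- (1/136) * real K))"
    unfolding sum_distrib_left e_def exp_add[symmetric] by (intro sum.cong) (auto simp: algebra_simps)
  also have "\<dots> \<le> exp (15/136 - 15/32 * M) * (exp (- (1/136) * (17/4 * M - 1)) * ((1 + 1/136) / (1/136)))"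
    using finX by (intro mult_left_mono sum_exp_le) (auto simp: X_def)
  \<comment> \<open>The exponents add up as 15/32 + 17/4 * 1/136 = 1/2 and 15/136 + 1/136 = 2/17.
    Below, 351 = 77 + 2 * 137.\<close>
  also have "\<dots> = exp (- M / 2) * (137 * exp (2/17))"
    unfolding mult.assoc[symmetric] exp_add[symmetric] by (simp add: exp_add[symmetric] algebra_simps)
  also have "exp (- M / 2) * 77 + exp (- M / 2) * (137 * exp (2/17)) \<le> exp (- M / 2) * 77 + exp (- M / 2) * (137 * 2)"
  proof -
    have "exp (2/17 :: real) \<le> 2"
      using exp_bound[of "2/17 :: real"] by (simp add: power2_eq_square)
    then show ?thesis by simp
  qed
  finally show ?thesis by (simp add: M_def)
qed

end

section \<open>The guarantee\<close>

lemma MMS_partition: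
  assumes "1 \<le> N"
  obtains P where "bundle_partition m N P" "\<And>l. l \<in> {1..N} \<Longrightarrow> MMS m N v \<le> v (P l)"
proof -
  define V where "V = {Min ((\<lambda>l. v (P l)) ` {1..N}) | P. bundle_partition m N P}"
  have "V \<subseteq> v ` Pow {1..m}"
  proof
    fix x assume "x \<in> V"
    then obtain P where P: "bundle_partition m N P" "x = Min ((\<lambda>l. v (P l)) ` {1..N})" by (auto simp: V_def)
    have "x \<in> (\<lambda>l. v (P l)) ` {1..N}" unfolding P(2) using assms by (intro Min_in) auto
    moreover have "P l \<subseteq> {1..m}" if "l \<in> {1..N}" for l
      using P(1) that unfolding bundle_partition_def by blast
    ultimately show "x \<in> v ` Pow {1..m}" by blast
  qed
  then have "finite V" by (rule finite_subset) simp
  moreover have "bundle_partition m N (\<lambda>l. if l = 1 then {1..m} else {})"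
    using assms by (auto simp: bundle_partition_def disjoint_family_on_def)
  then have "V \<noteq> {}" by (auto simp: V_def)
  ultimately have "Max V \<in> V" by (rule Max_in)
  then obtain P where P: "bundle_partition m N P" "MMS m N v = Min ((\<lambda>l. v (P l)) ` {1..N})"
    by (auto simp: V_def MMS_def)
  have "MMS m N v \<le> v (P l)" if "l \<in> {1..N}" for l
    unfolding P(2) using that by (intro Min_le) auto
  then show thesis using P(1) that by blast
qed

text \<open>Dividing by \<open>\<theta>\<close> makes the target one unit, and every bundle of an
  optimal partition is then worth at least 24. Disjointness of the bundles makes the representatives
  distinct, so the two counts add up to \<open>N\<close>.\<close>

lemma exists_agent_view:
  assumes v: "monotone_valuation m v" "submodular m v" and N: "1 \<le> N" and \<theta>: "0 < \<theta>" "24 * \<theta> = MMS m N v"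
  obtains Z U I P where "agent_view m (\<lambda>S. v S / \<theta>) Z U I P" "card Z + card I = N"
proof -
  obtain P where P: "bundle_partition m N P" "\<And>l. l \<in> {1..N} \<Longrightarrow> MMS m N v \<le> v (P l)"
    using MMS_partition[OF N] by metis
  have disj: "P k \<inter> P l = {}" if "k \<in> {1..N}" "l \<in> {1..N}" "k \<noteq> l" for k l
    using P(1) that by (auto simp: bundle_partition_def disjoint_family_on_def)
  have sub: "P l \<subseteq> {1..m}" if "l \<in> {1..N}" for l
    using P(1) that unfolding bundle_partition_def by blast
  define L where "L = {l \<in> {1..N}. \<exists>g\<in>P l. \<theta> \<le> v {g}}"
  have "\<forall>l\<in>L. \<exists>g. g \<in> P l \<and> \<theta> \<le> v {g}" by (auto simp: L_def)
  then obtain rep where rep: "\<And>l. l \<in> L \<Longrightarrow> rep l \<in> P l \<and> \<theta> \<le> v {rep l}" by metis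
  have LN: "L \<subseteq> {1..N}" by (auto simp: L_def)
  define I where "I = {1..N} - L"
  define U where "U = (\<Union>l\<in>I. P l)"
  have inj: "inj_on rep L"
  proof (rule inj_onI, rule ccontr)
    fix k l assume "k \<in> L" "l \<in> L" "rep k = rep l" "k \<noteq> l"
    moreover from this have "k \<in> {1..N}" "l \<in> {1..N}" using LN by auto
    ultimately show False using rep[of k] rep[of l] disj[of k l] by auto
  qed
  have "agent_view m (\<lambda>S. v S / \<theta>) (rep ` L) U I P"
  proof
    show "0 \<le> v S / \<theta>" if "S \<subseteq> {1..m}" for S
      using v(1) \<theta> that by (simp add: monotone_valuation_def)
    show "v S / \<theta> \<le> v T / \<theta>" if "S \<subseteq> T" "T \<subseteq> {1..m}" for S T
    proof -
      have "v S \<le> v T" using v(1) that by (auto simp: monotone_valuation_def mono_on_def)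
      then show ?thesis using \<theta> by (simp add: divide_right_mono)
    qed
    show "v (S \<union> T) / \<theta> + v (S \<inter> T) / \<theta> \<le> v S / \<theta> + v T / \<theta>" if "S \<subseteq> {1..m}" "T \<subseteq> {1..m}" for S T
      using v(2) \<theta> that by (simp add: submodular_def divide_right_mono add_divide_distrib[symmetric])
    show "rep ` L \<subseteq> {1..m}" using rep sub LN by blast
    show "U \<subseteq> {1..m}" unfolding U_def I_def using sub by blast
    show "rep ` L \<inter> U = {}"
    proof (rule ccontr)
      assume "rep ` L \<inter> U \<noteq> {}"
      then obtain l k where "l \<in> L" "k \<in> I" "rep l \<in> P k" by (auto simp: U_def)
      moreover from this have "l \<in> {1..N}" "k \<in> {1..N}" "l \<noteq> k" using LN by (auto simp: I_def)
      ultimately show False using rep[of l] disj[of l k] by auto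
    qed
    show "1 \<le> v {z} / \<theta>" if "z \<in> rep ` L" for z using rep that \<theta> by auto
    show "v {g} / \<theta> \<le> 1" if "g \<in> U" for g
    proof -
      obtain l where "l \<in> {1..N}" "l \<notin> L" "g \<in> P l" using \<open>g \<in> U\<close> by (auto simp: U_def I_def)
      then have "\<not> \<theta> \<le> v {g}" unfolding L_def by blast
      then show ?thesis using \<theta> by simp
    qed
    show "finite I" by (simp add: I_def)
    show "P l \<subseteq> U" if "l \<in> I" for l using that by (auto simp: U_def)
    show "disjoint_family_on P I"
      using P(1) by (auto simp: bundle_partition_def I_def disjoint_family_on_def)
    show "24 \<le> v (P l) / \<theta>" if "l \<in> I" for l
      using P(2)[of l] that \<theta> by (simp add: I_def field_simps)
  qed
  moreover have "card (rep ` L) + card I = N"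
  proof -
    have "card L \<le> N" using card_mono[OF _ LN] by simp
    then show ?thesis using card_image[OF inj] LN by (simp add: I_def card_Diff_subset finite_subset)
  qed
  ultimately show thesis by (rule that)
qed

section \<open>The online algorithm\<close>

definition target :: "nat \<Rightarrow> nat \<Rightarrow> valuation \<Rightarrow> real" where
  "target m N w = MMS m N w / 24"

text \<open>Valuations and coin tosses are indexed from 0 here, so \<open>w i\<close> and \<open>\<omega> i\<close> belong to agent
  \<open>i + 1\<close>, before whom \<open>i\<close> agents have been served.\<close>

definition remaining :: "nat \<Rightarrow> nat \<Rightarrow> (nat \<Rightarrow> valuation) \<Rightarrow> (nat \<Rightarrow> nat set list) \<Rightarrow> nat \<Rightarrow> nat set" where
  "remaining m N w = trace (\<lambda>i a R. R - pick m (rate N i) (target m N (w i)) (w i) R a) {1..m}"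

text \<open>The earlier decisions are replayed from the revealed valuations and the seeds, because a
  deterministic online algorithm is given valuations only.\<close>

definition single_or_sample :: "nat \<Rightarrow> nat \<Rightarrow> (nat \<Rightarrow> nat set list) \<Rightarrow> det_online" where
  "single_or_sample m N \<omega> vs = (let i = length vs - 1 in
    pick m (rate N i) (target m N (vs ! i)) (vs ! i) (remaining m N ((!) vs) \<omega> i) (\<omega> i))"

lemma remaining_Suc: "remaining m N w \<omega> (Suc i)
    = remaining m N w \<omega> i - pick m (rate N i) (target m N (w i)) (w i) (remaining m N w \<omega> i) (\<omega> i)"
  by (simp add: remaining_def)

lemma remaining_cong: "(\<And>k. k < i \<Longrightarrow> w k = w' k) \<Longrightarrow> remaining m N w \<omega> i = remaining m N w' \<omega> i"
  by (induction i) (simp_all add: remaining_def)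

lemma alloc_single_or_sample:
  "alloc (single_or_sample m N \<omega>) v (Suc i)
    = pick m (rate N i) (target m N (v (Suc i))) (v (Suc i)) (remaining m N (\<lambda>k. v (Suc k)) \<omega> i) (\<omega> i)"
proof -
  let ?vs = "map v [1..<Suc (Suc i)]"
  have nth: "?vs ! k = v (Suc k)" if "k \<le> i" for k
    using that by (subst nth_map) (auto simp del: upt_Suc)
  have "remaining m N ((!) ?vs) \<omega> i = remaining m N (\<lambda>k. v (Suc k)) \<omega> i"
    by (rule remaining_cong) (use nth in auto)
  then show ?thesis using nth[of i] by (simp add: alloc_def single_or_sample_def del: upt_Suc)
qed

lemma remaining_eq:
  "remaining m N (\<lambda>k. v (Suc k)) \<omega> i = {1..m} - (\<Union>j\<in>{1..<Suc i}. alloc (single_or_sample m N \<omega>) v j)"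
proof (induction i)
  case (Suc i)
  have "{1..<Suc (Suc i)} = insert (Suc i) {1..<Suc i}" by auto
  moreover have "remaining m N (\<lambda>k. v (Suc k)) \<omega> (Suc i)
      = remaining m N (\<lambda>k. v (Suc k)) \<omega> i - alloc (single_or_sample m N \<omega>) v (Suc i)"
    by (simp add: remaining_Suc alloc_single_or_sample)
  ultimately show ?case unfolding Suc by auto
qed (simp add: remaining_def)

lemma det_online_single_or_sample: "det_online_algorithm m n (single_or_sample m N \<omega>)"
  unfolding det_online_algorithm_def
proof (intro allI impI ballI)
  fix v i assume "i \<in> {1..n}"
  then obtain k where i: "i = Suc k" by (cases i) auto
  show "alloc (single_or_sample m N \<omega>) v i \<subseteq> {1..m} - (\<Union>j\<in>{1..<i}. alloc (single_or_sample m N \<omega>) v j)"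
    unfolding i remaining_eq[symmetric] alloc_single_or_sample by (rule pick_subset)
qed

text \<open>The entries \<open>\<sigma>\<close> and \<open>k\<close> are bookkeeping and never
  influence the goods, so the views of all agents describe one and the same process.\<close>

lemma (in agent_view) fst_trace_step:
  "fst (trace (step N (\<lambda>i. target m N (w i)) w) ({1..m}, 1, 0) \<omega> i) = remaining m N w \<omega> i"
proof (induction i)
  case (Suc i)
  then show ?case
    by (cases "trace (step N (\<lambda>i. target m N (w i)) w) ({1..m}, 1, 0) \<omega> i")
      (simp add: remaining_Suc, simp add: step_def Let_def)
qed (simp add: remaining_def)

lemma samplable_scale: "0 < \<theta> \<Longrightarrow> samplable m q 1 (\<lambda>S. w S / \<theta>) R \<longleftrightarrow> samplable m q \<theta> w R"
  by (simp add: samplable_def)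

lemma stuck_probability:
  assumes w: "\<And>i. i < n \<Longrightarrow> monotone_valuation m (w i) \<and> submodular m (w i)" and "n \<le> N" "j < n"
  shows "measure_pmf.expectation (seeds (\<lambda>i. attempts m T (rate N i)) j)
      (\<lambda>\<omega>. of_bool (\<not> (\<exists>g\<in>remaining m N w \<omega> j. target m N (w j) \<le> w j {g})
        \<and> \<not> samplable m (rate N j) (target m N (w j)) (w j) (remaining m N w \<omega> j)))
    \<le> 351 * exp (- (real N - real j) / 2)"
proof (cases "0 < target m N (w j)")
  case True
  define \<theta> where "\<theta> = target m N (w j)"
  have \<theta>: "0 < \<theta>" "24 * \<theta> = MMS m N (w j)" using True by (auto simp: \<theta>_def target_def)
  have N: "1 \<le> N" "j < N" using assms by auto
  obtain Z U I P where view: "agent_view m (\<lambda>S. w j S / \<theta>) Z U I P" and card: "card Z + card I = N"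
    using exists_agent_view[OF _ _ N(1) \<theta>] w[OF assms(3)] by blast
  interpret agent_view m "\<lambda>S. w j S / \<theta>" Z U I P by (rule view)
  have "stuck N j R \<longleftrightarrow> \<not> (\<exists>g\<in>R. \<theta> \<le> w j {g}) \<and> \<not> samplable m (rate N j) \<theta> (w j) R" for R
    unfolding stuck_def samplable_scale[OF \<theta>(1)] using \<theta>(1) by simp
  then show ?thesis
    using stuck_prob[OF N(2) card, of T "\<lambda>i. target m N (w i)" w] unfolding fst_trace_step \<theta>_def by simp
next
  case False
  \<comment> \<open>A target that is not positive is reached by every draw.\<close>
  have "samplable m (rate N j) (target m N (w j)) (w j) (remaining m N w \<omega> j)" for \<omega>
  proof -
    have "remaining m N w \<omega> j \<subseteq> {1..m}" by (induction j) (auto simp: remaining_Suc remaining_def[of m N w])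
    then have "0 \<le> w j (S \<inter> remaining m N w \<omega> j)" for S
      using w[OF assms(3)] unfolding monotone_valuation_def by (meson inf.coboundedI2)
    then have "target m N (w j) \<le> w j (S \<inter> remaining m N w \<omega> j)" for S
      using False by (meson not_less order_trans)
    then show ?thesis by (simp add: samplable_def)
  qed
  then show ?thesis by simp
qed

section \<open>Union bound over the agents\<close>

lemma square_le_4_power: "real n ^ 2 \<le> 4 ^ n"
proof -
  have "real n \<le> 2 ^ n" using of_nat_less_two_power[of n, where ?'a = real] by simp
  then have "real n ^ 2 \<le> (2 ^ n) ^ 2" by (intro power_mono) auto
  also have "(2 ^ n) ^ 2 = (4 :: real) ^ n" by (simp add: power_mult[symmetric] mult.commute[of n] power_mult)
  finally show ?thesis .
qed

text \<open>An agent can fail only by being stuck or by missing with all \<open>2 * n\<close> draws.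
  The former probabilities sum geometrically to at most \<open>351 * 3 / N\<close>; the latter are
  at most \<open>1 / 4 ^ n\<close> each, hence at most \<open>1 / n\<close> in total. The constant
  is 1054 = 3 * 351 + 1.\<close>

lemma failure_probability:
  assumes N: "int N \<ge> int n + \<lceil>2 * ln (real N)\<rceil>" "1 \<le> N" and n: "1 \<le> n"
    and v: "\<And>i. i \<in> {1..n} \<Longrightarrow> monotone_valuation m (v i) \<and> submodular m (v i)"
  shows "measure_pmf.prob (map_pmf (single_or_sample m N) (seeds (\<lambda>i. attempts m (2 * n) (rate N i)) n))
      {d. \<forall>i\<in>{1..n}. v i (alloc d v i) \<ge> 1 / 24 * MMS m N (v i)} \<ge> 1 - 1054 / real n"
proof -
  define w where "w = (\<lambda>k. v (Suc k))"
  define \<theta> where "\<theta> = (\<lambda>k. target m N (w k))"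
  define A where "A = (\<lambda>i. attempts m (2 * n) (rate N i))"
  define R where "R = remaining m N w"
  define big where "big = (\<lambda>i \<omega>. \<exists>g\<in>R \<omega> i. \<theta> i \<le> w i {g})"
  define sam where "sam = (\<lambda>i \<omega>. samplable m (rate N i) (\<theta> i) (w i) (R \<omega> i))"
  define miss where "miss = (\<lambda>i \<omega>. \<forall>S\<in>set (\<omega> i). \<not> \<theta> i \<le> w i (S \<inter> R \<omega> i))"
  define good where "good = (\<lambda>\<omega>. \<forall>i\<in>{1..n}. v i (alloc (single_or_sample m N \<omega>) v i) \<ge> 1 / 24 * MMS m N (v i))"
  have Nn: "2 * ln (real N) \<le> real N - real n" "n \<le> N"
  proof -
    have "2 * ln (real N) \<le> of_int \<lceil>2 * ln (real N)\<rceil>" by (rule le_of_int_ceiling)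
    moreover have "of_int \<lceil>2 * ln (real N)\<rceil> \<le> real N - real n" using N(1) by linarith
    ultimately show "2 * ln (real N) \<le> real N - real n" by linarith
    moreover have "0 \<le> ln (real N)" using N(2) by simp
    ultimately show "n \<le> N" by linarith
  qed
  have fin: "finite (set_pmf (A i))" for i by (simp add: A_def)
  have int: "integrable (measure_pmf (seeds A j)) f" for j and f :: "_ \<Rightarrow> real"
    by (rule integrable_measure_pmf_finite) (simp add: fin)
  have R_cong: "R \<omega> i = R \<omega>' i" if "\<And>k. k < i \<Longrightarrow> \<omega> k = \<omega>' k" for \<omega> \<omega>' i
    unfolding R_def remaining_def by (rule trace_cong) (rule that)
  have fail: "1 - of_bool (good \<omega>) \<le> (\<Sum>i<n. of_bool (\<not> big i \<omega> \<and> \<not> sam i \<omega>) + of_bool (sam i \<omega> \<and> miss i \<omega>) :: real)" for \<omega>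
  proof (cases "\<exists>i<n. (\<not> big i \<omega> \<and> \<not> sam i \<omega>) \<or> (sam i \<omega> \<and> miss i \<omega>)")
    case True
    then obtain i where i: "i < n" "(\<not> big i \<omega> \<and> \<not> sam i \<omega>) \<or> (sam i \<omega> \<and> miss i \<omega>)" by blast
    have "1 \<le> (of_bool (\<not> big i \<omega> \<and> \<not> sam i \<omega>) + of_bool (sam i \<omega> \<and> miss i \<omega>) :: real)" using i(2) by auto
    also have "\<dots> \<le> (\<Sum>i<n. of_bool (\<not> big i \<omega> \<and> \<not> sam i \<omega>) + of_bool (sam i \<omega> \<and> miss i \<omega>))"
      using i(1) by (intro member_le_sum[where f = "\<lambda>i. of_bool (\<not> big i \<omega> \<and> \<not> sam i \<omega>) + of_bool (sam i \<omega> \<and> miss i \<omega>)"]) auto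
    finally show ?thesis by (rule order_trans[rotated]) simp
  next
    case False
    have "good \<omega>" unfolding good_def
    proof
      fix j assume "j \<in> {1..n}"
      then obtain i where i: "j = Suc i" "i < n" by (cases j) auto
      have "\<theta> i \<le> w i (pick m (rate N i) (\<theta> i) (w i) (R \<omega> i) (\<omega> i))"
      proof (cases "big i \<omega>")
        case True
        then show ?thesis
          unfolding big_def by (metis pick_large)
      next
        case nb: False
        then have s: "sam i \<omega>" "\<not> miss i \<omega>" using False i(2) by auto
        then have "pick m (rate N i) (\<theta> i) (w i) (R \<omega> i) (\<omega> i) = first_good (\<theta> i) (w i) (R \<omega> i) (\<omega> i)"
          using nb by (auto simp: pick_def big_def sam_def)
        then show ?thesis using s(2) by (auto simp: miss_def intro!: first_good_value)
      qed
      then show "v j (alloc (single_or_sample m N \<omega>) v j) \<ge> 1 / 24 * MMS m N (v j)"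
        unfolding i(1) alloc_single_or_sample by (simp add: w_def \<theta>_def R_def target_def)
    qed
    then show ?thesis by (auto intro!: sum_nonneg)
  qed
  have P1: "measure_pmf.expectation (seeds A n) (\<lambda>\<omega>. of_bool (\<not> big i \<omega> \<and> \<not> sam i \<omega>))
      \<le> 351 * exp (- (real N - real i) / 2)" if i: "i < n" for i
  proof -
    \<comment> \<open>Whether agent \<open>i + 1\<close> is stuck is decided by the seeds of the
      agents before her.\<close>
    have "measure_pmf.expectation (seeds A n) (\<lambda>\<omega>. of_bool (\<not> big i \<omega> \<and> \<not> sam i \<omega>) :: real)
        = measure_pmf.expectation (seeds A i) (\<lambda>\<omega>. of_bool (\<not> big i \<omega> \<and> \<not> sam i \<omega>))"
    proof (rule expectation_seeds_prefix[OF fin])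
      fix \<omega> \<omega>' :: "nat \<Rightarrow> nat set list" assume "\<And>k. k < i \<Longrightarrow> \<omega> k = \<omega>' k"
      then have "R \<omega> i = R \<omega>' i" by (rule R_cong)
      then show "of_bool (\<not> big i \<omega> \<and> \<not> sam i \<omega>) = (of_bool (\<not> big i \<omega>' \<and> \<not> sam i \<omega>') :: real)"
        by (simp add: big_def sam_def)
    qed (use i in simp)
    also have "\<dots> \<le> 351 * exp (- (real N - real i) / 2)"
      unfolding big_def sam_def \<theta>_def R_def A_def
      by (rule stuck_probability[OF _ Nn(2) i]) (use v in \<open>auto simp: w_def\<close>)
    finally show ?thesis .
  qed
  have P2: "measure_pmf.expectation (seeds A n) (\<lambda>\<omega>. of_bool (sam i \<omega> \<and> miss i \<omega>)) \<le> (1/2 :: real) ^ (2 * n)" if i: "i < n" for i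
  proof -
    have "measure_pmf.expectation (seeds A n) (\<lambda>\<omega>. of_bool (sam i \<omega> \<and> miss i \<omega>) :: real)
        = measure_pmf.expectation (seeds A (Suc i)) (\<lambda>\<omega>. of_bool (sam i \<omega> \<and> miss i \<omega>))"
    proof (rule expectation_seeds_prefix[OF fin])
      fix \<omega> \<omega>' :: "nat \<Rightarrow> nat set list" assume *: "\<And>k. k < Suc i \<Longrightarrow> \<omega> k = \<omega>' k"
      then have "R \<omega> i = R \<omega>' i" by (intro R_cong) auto
      then show "of_bool (sam i \<omega> \<and> miss i \<omega>) = (of_bool (sam i \<omega>' \<and> miss i \<omega>') :: real)"
        using *[of i] by (simp add: miss_def sam_def)
    qed (use i in simp)
    also have "\<dots> = measure_pmf.expectation (seeds A i) (\<lambda>\<omega>. measure_pmf.expectation (A i)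
        (\<lambda>a. of_bool (sam i \<omega> \<and> (\<forall>S\<in>set a. \<not> \<theta> i \<le> w i (S \<inter> R \<omega> i)))))"
    proof -
      \<comment> \<open>Her own draws do not affect what she finds, so they can be averaged with
        \<open>R \<omega> i\<close> held fixed.\<close>
      have "R (fun_upd \<omega> i a) i = R \<omega> i" for \<omega> a by (rule R_cong) auto
      then show ?thesis by (simp add: expectation_seeds_Suc[OF fin] sam_def miss_def del: seeds.simps)
    qed
    also have "\<dots> \<le> measure_pmf.expectation (seeds A i) (\<lambda>\<omega>. (1/2) ^ (2 * n))"
    proof (rule integral_mono_AE[OF int int], rule AE_I2)
      fix \<omega>
      show "measure_pmf.expectation (A i) (\<lambda>a. of_bool (sam i \<omega> \<and> (\<forall>S\<in>set a. \<not> \<theta> i \<le> w i (S \<inter> R \<omega> i)))) \<le> (1/2 :: real) ^ (2 * n)"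
      proof (cases "sam i \<omega>")
        case True
        then show ?thesis using prob_all_attempts_fail[of m "rate N i" "\<theta> i" "w i" "R \<omega> i" "2 * n"]
          by (simp add: sam_def A_def)
      qed simp
    qed
    finally show ?thesis by simp
  qed
  have S1: "(\<Sum>i<n. 351 * exp (- (real N - real i) / 2)) \<le> 1053 / real n"
  proof -
    have "(\<Sum>i<n. exp (- (real N - real i) / 2)) = (\<Sum>k\<in>(\<lambda>i. N - i) ` {..<n}. exp (- (1/2) * real k))"
    proof (subst sum.reindex)
      show "inj_on (\<lambda>i. N - i) {..<n}" using Nn(2) by (auto simp: inj_on_def)
      show "(\<Sum>i<n. exp (- (real N - real i) / 2)) = sum ((\<lambda>k. exp (- (1/2) * real k)) \<circ> (\<lambda>i. N - i)) {..<n}"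
        using Nn(2) by (intro sum.cong) (simp_all add: of_nat_diff diff_divide_distrib)
    qed
    also have "\<dots> \<le> exp (- (1/2) * (real N - real n)) * ((1 + 1/2) / (1/2))"
    proof (rule sum_exp_le)
      fix k assume "k \<in> (\<lambda>i. N - i) ` {..<n}"
      then show "real N - real n \<le> real k" using Nn(2) by (auto simp: of_nat_diff)
    qed auto
    \<comment> \<open>The gap \<open>N - n \<ge> 2 * ln N\<close> turns the exponential into
      \<open>1 / N\<close>.\<close>
    also have "\<dots> \<le> exp (- ln (real N)) * 3" using Nn(1) by simp
    also have "\<dots> = 3 / real N" using N(2) by (simp add: exp_minus field_simps)
    also have "\<dots> \<le> 3 / real n" using Nn(2) n by (intro divide_left_mono) auto
    finally have "351 * (\<Sum>i<n. exp (- (real N - real i) / 2)) \<le> 351 * (3 / real n)" by simp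
    then show ?thesis by (simp add: sum_distrib_left)
  qed
  have S2: "real n * (1/2) ^ (2 * n) \<le> 1 / real n"
  proof -
    have "(1/2 :: real) ^ (2 * n) = 1 / 4 ^ n" by (simp add: power_mult power2_eq_square power_one_over)
    then show ?thesis using square_le_4_power[of n] n by (simp add: field_simps power2_eq_square)
  qed
  have "1 - measure_pmf.expectation (seeds A n) (\<lambda>\<omega>. of_bool (good \<omega>)) = measure_pmf.expectation (seeds A n) (\<lambda>\<omega>. 1 - of_bool (good \<omega>) :: real)"
    by (simp add: int)
  also have "\<dots> \<le> measure_pmf.expectation (seeds A n) (\<lambda>\<omega>. \<Sum>i<n. of_bool (\<not> big i \<omega> \<and> \<not> sam i \<omega>) + of_bool (sam i \<omega> \<and> miss i \<omega>))"
    by (rule integral_mono_AE[OF int int], rule AE_I2, rule fail)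
  also have "\<dots> = (\<Sum>i<n. measure_pmf.expectation (seeds A n) (\<lambda>\<omega>. of_bool (\<not> big i \<omega> \<and> \<not> sam i \<omega>))
      + measure_pmf.expectation (seeds A n) (\<lambda>\<omega>. of_bool (sam i \<omega> \<and> miss i \<omega>)))"
    by (simp add: int)
  also have "\<dots> \<le> (\<Sum>i<n. 351 * exp (- (real N - real i) / 2) + (1/2) ^ (2 * n))"
    using P1 P2 by (intro sum_mono add_mono) auto
  also have "\<dots> \<le> 1053 / real n + 1 / real n"
    using S1 S2 by (simp add: sum.distrib)
  also have "\<dots> = 1054 / real n" by (simp add: add_divide_distrib[symmetric])
  finally have "1 - 1054 / real n \<le> measure_pmf.expectation (seeds A n) (\<lambda>\<omega>. of_bool (good \<omega>))" by simp
  also have "\<dots> = measure_pmf.prob (seeds A n) {\<omega>. good \<omega>}"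
  proof -
    have "(\<lambda>\<omega>. of_bool (good \<omega>)) = (indicator {\<omega>. good \<omega>} :: _ \<Rightarrow> real)" by (auto simp: indicator_def)
    then show ?thesis by simp
  qed
  also have "{\<omega>. good \<omega>} = single_or_sample m N -` {d. \<forall>i\<in>{1..n}. v i (alloc d v i) \<ge> 1 / 24 * MMS m N (v i)}"
    by (auto simp: good_def)
  finally show ?thesis by (simp add: A_def)
qed

theorem corollary6p3:
  shows "\<exists>C::real. C > 0 \<and>
    (\<forall>(N::nat) (n::nat).
      N \<ge> 1 \<longrightarrow> n \<ge> 1 \<longrightarrow> int N \<ge> int n + \<lceil>2 * ln (real N)\<rceil> \<longrightarrow>
      (\<exists>R :: nat \<Rightarrow> det_online pmf.
        \<forall>m. randomized_online_algorithm m n (R m) \<and>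
          (\<forall>v :: nat \<Rightarrow> valuation.
            (\<forall>i\<in>{1..n}. monotone_valuation m (v i) \<and> submodular m (v i)) \<longrightarrow>
            measure_pmf.prob (R m)
              {d. \<forall>i\<in>{1..n}. v i (alloc d v i) \<ge> 1 / 24 * MMS m N (v i)}
              \<ge> 1 - C / real n)))"
proof (intro exI[of _ 1054] conjI allI impI)
  fix N n :: nat assume N: "1 \<le> N" and n: "1 \<le> n" and Nn: "int N \<ge> int n + \<lceil>2 * ln (real N)\<rceil>"
  define R where "R = (\<lambda>m. map_pmf (single_or_sample m N) (seeds (\<lambda>i. attempts m (2 * n) (rate N i)) n))"
  show "\<exists>R :: nat \<Rightarrow> det_online pmf.
        \<forall>m. randomized_online_algorithm m n (R m) \<and>
          (\<forall>v :: nat \<Rightarrow> valuation.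
            (\<forall>i\<in>{1..n}. monotone_valuation m (v i) \<and> submodular m (v i)) \<longrightarrow>
            measure_pmf.prob (R m)
              {d. \<forall>i\<in>{1..n}. v i (alloc d v i) \<ge> 1 / 24 * MMS m N (v i)}
              \<ge> 1 - 1054 / real n)"
  proof (rule exI[of _ R], intro allI conjI impI)
    fix m
    show "randomized_online_algorithm m n (R m)"
      by (auto simp: randomized_online_algorithm_def R_def det_online_single_or_sample)
    fix v :: "nat \<Rightarrow> valuation"
    assume "\<forall>i\<in>{1..n}. monotone_valuation m (v i) \<and> submodular m (v i)"
    then show "measure_pmf.prob (R m)
              {d. \<forall>i\<in>{1..n}. v i (alloc d v i) \<ge> 1 / 24 * MMS m N (v i)} \<ge> 1 - 1054 / real n"
      unfolding R_def by (intro failure_probability[OF Nn N n]) auto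
  qed
qed simp

end
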